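(* Let $\mathscr{H}$ be a complex Hilbert space, let $T\in\mathbb{B}(\mathscr{H})$, let $0\le t\le 1$, and put $Q_t=|T^*|^{2(1-t)}+|T|^{2t}$. Then $$w(T) \leq \sqrt{ \frac{1}{16}\left \|Q_t \right\|^2+\frac14 w^2(T)+\frac18 w(TQ_t+Q_tT)}\ \leq\ \frac14 \left\||T^*|^{2(1-t)}+|T|^{2t}\right\|+\frac12 w(T)\ \leq\ \frac12 \left \||T^*|^{2(1-t)}+|T|^{2t} \right\|.$$
   Context: $\mathbb{B}(\mathscr{H})$ denotes the bounded linear operators on $\mathscr{H}$, $\|\cdot\|$ the operator norm, $|T|=(T^*T)^{1/2}$ and $|T^*|=(TT^* )^{1/2}$. The numerical radius is $w(T)=\sup\{|\langle Tx,x\rangle| : x\in\mathscr{H},\ \|x\|=1\}$, and $w^2(T)=(w(T))^2$. Powers of positive operators are given by the continuous functional calculus, with $A^0=I$. *)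

theory Defs
  imports "HOL-Analysis.Analysis" "HOL-Computational_Algebra.Polynomial"
begin

class complex_vector = real_vector +
  fixes scaleC :: "complex \<Rightarrow> 'a \<Rightarrow> 'a" (infixr "*\<^sub>C" 75)
  assumes scaleC_add_right: "a *\<^sub>C (x + y) = a *\<^sub>C x + a *\<^sub>C y"
    and scaleC_add_left: "(a + b) *\<^sub>C x = a *\<^sub>C x + b *\<^sub>C x"
    and scaleC_scaleC: "a *\<^sub>C b *\<^sub>C x = (a * b) *\<^sub>C x"
    and scaleC_one: "1 *\<^sub>C x = x"
    and scaleR_eq_scaleC: "r *\<^sub>R x = complex_of_real r *\<^sub>C x"

text \<open>The complex inner product is linear in its first argument. The real inner product
  inherited from \<open>real_inner\<close> is its real part, so that the inherited norm is
  \<open>norm x = sqrt (Re (cinner x x))\<close>.\<close>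

class complex_inner = complex_vector + real_inner +
  fixes cinner :: "'a \<Rightarrow> 'a \<Rightarrow> complex"
  assumes cinner_add_left: "cinner (x + y) z = cinner x z + cinner y z"
    and cinner_scaleC_left: "cinner (a *\<^sub>C x) y = a * cinner x y"
    and cinner_commute: "cinner x y = cnj (cinner y x)"
    and inner_eq_Re_cinner: "inner x y = Re (cinner x y)"

class complex_hilbert_space = complex_inner + complete_space

instantiation complex :: complex_hilbert_space
begin

definition scaleC_complex :: "complex \<Rightarrow> complex \<Rightarrow> complex"
  where "scaleC_complex a x = a * x"

definition cinner_complex :: "complex \<Rightarrow> complex \<Rightarrow> complex"
  where "cinner_complex x y = x * cnj y"

instance
  by standard
    (auto simp: scaleC_complex_def cinner_complex_def algebra_simps inner_complex_def
      scaleR_conv_of_real)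

end

definition bounded_clinear :: "('a::complex_inner \<Rightarrow> 'a) \<Rightarrow> bool"
  where "bounded_clinear T \<longleftrightarrow> bounded_linear T \<and> (\<forall>c x. T (c *\<^sub>C x) = c *\<^sub>C T x)"

definition cadjoint :: "('a::complex_inner \<Rightarrow> 'a) \<Rightarrow> 'a \<Rightarrow> 'a"
  where "cadjoint T = (THE S. \<forall>x y. cinner (T x) y = cinner x (S y))"

text \<open>The supremum is taken in the nonnegative reals: inserting \<open>0\<close> only matters on the zero
  space, which has no unit vectors and where the numerical radius is \<open>0\<close>.\<close>

definition numerical_radius :: "('a::complex_inner \<Rightarrow> 'a) \<Rightarrow> real"
  where "numerical_radius T = Sup (insert 0 {cmod (cinner (T x) x) | x. norm x = 1})"

definition op_spectrum :: "('a::complex_inner \<Rightarrow> 'a) \<Rightarrow> complex set"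
  where "op_spectrum A = {c. \<not> (\<exists>S. bounded_clinear S \<and>
    (\<forall>x. S (A x - c *\<^sub>C x) = x) \<and> (\<forall>x. A (S x) - c *\<^sub>C S x = x))}"

definition poly_op :: "real poly \<Rightarrow> ('a::complex_inner \<Rightarrow> 'a) \<Rightarrow> 'a \<Rightarrow> 'a"
  where "poly_op p A = (\<lambda>x. \<Sum>i\<le>degree p. coeff p i *\<^sub>R (A ^^ i) x)"

text \<open>For self-adjoint \<open>A\<close> (whose spectrum is real and compact) and \<open>f\<close> continuous on the
  spectrum, \<open>f(A)\<close> is the operator-norm limit of \<open>p\<^sub>n(A)\<close> for any real polynomials \<open>p\<^sub>n\<close>
  converging to \<open>f\<close> uniformly on the spectrum; such \<open>p\<^sub>n\<close> exist by Weierstrass.\<close>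

definition cont_fun_calc :: "(real \<Rightarrow> real) \<Rightarrow> ('a::complex_inner \<Rightarrow> 'a) \<Rightarrow> 'a \<Rightarrow> 'a"
  where "cont_fun_calc f A = (THE B. bounded_clinear B \<and>
    (\<forall>p :: nat \<Rightarrow> real poly.
      uniform_limit {r. complex_of_real r \<in> op_spectrum A} (\<lambda>n. poly (p n)) f sequentially \<longrightarrow>
      (\<lambda>n. onorm (\<lambda>x. poly_op (p n) A x - B x)) \<longlonglongrightarrow> 0))"

text \<open>The exponent \<open>0\<close> is treated separately because \<open>0 powr 0 = 0\<close>, whereas \<open>A\<^sup>0\<close> is the
  identity also when \<open>0\<close> lies in the spectrum of \<open>A\<close>.\<close>

definition op_powr :: "('a::complex_inner \<Rightarrow> 'a) \<Rightarrow> real \<Rightarrow> 'a \<Rightarrow> 'a"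
  where "op_powr A s = (if s = 0 then id else cont_fun_calc (\<lambda>r. r powr s) A)"

definition op_abs :: "('a::complex_inner \<Rightarrow> 'a) \<Rightarrow> 'a \<Rightarrow> 'a"
  where "op_abs T = op_powr (cadjoint T \<circ> T) (1 / 2)"

end

(*
  The mixed Schwarz inequality |<Tx,x>| <= || |T|^t x || || |T^*|^(1-t) x || gives
  2 |<Tx,x>| <= <Qx,x> with Q = |T^*|^(2(1-t)) + |T|^(2t), hence the last inequality. For a unit
  vector x choose a unimodular c with c <Tx,x> = |<Tx,x>| and let H be the real part of cT, so that
  ||H|| <= w(T). Then |<Tx,x>| <= ||(Q/4 + H/2) x||, and expanding the square gives the first
  inequality because 2 Re <Qx,Hx> = Re (c <(TQ + QT)x,x>). The same identity gives
  w(TQ + QT) <= 2 ||Q|| w(T), which makes the term under the root at most a complete square.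

  The functional calculus rests on ||p(A)|| <= sup |p| over the spectrum: a polynomial without roots
  in the spectrum of A is bounded below at A, whereas S^2 - ||S||^2 is never bounded below.
*)
theory Submission
  imports Defs "HOL-Computational_Algebra.Fundamental_Theorem_Algebra"
begin

subsection \<open>Real Hilbert spaces\<close>

text \<open>\<open>cont_fun_calc\<close> is a definite description over all approximating polynomial
  sequences, so existence and uniqueness of the limit are owed before any use; both reduce to the
  norm bound for polynomials on the spectrum. The spectrum enters that bound only through lower
  estimates for A - r. The converse, that a lower estimate puts r outside the spectrum, confines the
  spectrum of a positive operator to an interval \<open>{0..M}\<close>. It needs surjectivity, hence
  the projection theorem, which also yields the adjoint through Riesz. From then on functions are
  approximated on \<open>{0..M}\<close> rather than on the spectrum. Write T' for the adjoint: if M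
  bounds the norms of T'T and TT', one polynomial sequence serves both operators, and T f(T'T) =
  f(TT') T follows in the limit. Much of the argument runs in the real inner product; multiplication
  by i recovers the complex identities.\<close>

instance complex_hilbert_space \<subseteq> banach ..

lemma orthogonal_projection_exists:
  fixes V :: "'a::{real_inner,banach} set"
  assumes V: "subspace V" "closed V"
  obtains v where "v \<in> V" "\<And>u. u \<in> V \<Longrightarrow> inner (x - v) u = 0"
proof -
  define d where "d = infdist x V"
  have ne: "V \<noteq> {}" using subspace_0[OF V(1)] by auto
  have d0: "0 \<le> d" unfolding d_def by (rule infdist_nonneg)
  have dle: "d \<le> norm (x - w)" if "w \<in> V" for w
    unfolding d_def using infdist_le[OF that] by (simp add: dist_norm)
  have "\<exists>v\<in>V. norm (x - v) < d + 1 / Suc n" for n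
  proof (rule ccontr)
    assume "\<not> ?thesis"
    then have "\<And>v. v \<in> V \<Longrightarrow> d + 1 / Suc n \<le> dist x v" by (force simp: dist_norm)
    then have "d + 1 / Suc n \<le> infdist x V"
      unfolding infdist_notempty[OF ne] by (intro cINF_greatest[OF ne])
    then show False unfolding d_def by (simp add: field_simps)
  qed
  then obtain v where v: "\<And>n. v n \<in> V" "\<And>n. norm (x - v n) < d + 1 / Suc n" by metis
  \<comment> \<open>By the parallelogram law the squared distance of two approximants is at most
    2a^2 + 2b^2 - 4d^2, since their midpoint lies in \<open>V\<close>; here a and b are at most d +
    1/(N+1).\<close>
  define g where "g n = 4 * ((d + 1 / Suc n)\<^sup>2 - d\<^sup>2)" for n :: nat
  have "(\<lambda>n. 1 / real (Suc n)) \<longlonglongrightarrow> 0"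
    using LIMSEQ_inverse_real_of_nat by (simp add: inverse_eq_divide)
  then have "(\<lambda>n. 4 * ((d + 1 / real (Suc n))\<^sup>2 - d\<^sup>2)) \<longlonglongrightarrow> 4 * ((d + 0)\<^sup>2 - d\<^sup>2)"
    by (intro tendsto_intros)
  then have g0: "g \<longlonglongrightarrow> 0" unfolding g_def by simp
  have diff: "(norm (v m - v n))\<^sup>2 \<le> g N" if "N \<le> m" "N \<le> n" for m n N
  proof -
    have near: "(norm (x - v k))\<^sup>2 \<le> (d + 1 / Suc N)\<^sup>2" if "N \<le> k" for k
    proof (rule power_mono)
      have "1 / real (Suc k) \<le> 1 / Suc N" using that by (simp add: field_simps)
      then show "norm (x - v k) \<le> d + 1 / Suc N" using v(2)[of k] by linarith
    qed simp
    have "(1/2) *\<^sub>R (v m + v n) \<in> V"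
      by (intro subspace_scale subspace_add V v)
    then have "d\<^sup>2 \<le> (norm (x - (1/2) *\<^sub>R (v m + v n)))\<^sup>2"
      using dle d0 by (intro power_mono) auto
    moreover have "(norm (v m - v n))\<^sup>2 = 2 * (norm (x - v m))\<^sup>2 + 2 * (norm (x - v n))\<^sup>2
        - 4 * (norm (x - (1/2) *\<^sub>R (v m + v n)))\<^sup>2"
      by (simp add: power2_norm_eq_inner inner_diff_left inner_diff_right inner_add_left
          inner_add_right inner_commute algebra_simps)
    ultimately show ?thesis using near[OF that(1)] near[OF that(2)] unfolding g_def by simp
  qed
  have "Cauchy v"
  proof (rule CauchyI)
    fix e :: real assume "0 < e"
    then obtain N where "g N < e\<^sup>2"
      using order_tendstoD(2)[OF g0, of "e\<^sup>2"] by (auto simp: eventually_sequentially)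
    then have "norm (v m - v n) < e" if "N \<le> m" "N \<le> n" for m n
      using diff[OF that] \<open>0 < e\<close> by (intro power2_less_imp_less[of _ e]) auto
    then show "\<exists>N. \<forall>m\<ge>N. \<forall>n\<ge>N. norm (v m - v n) < e" by blast
  qed
  then obtain l where l: "v \<longlonglongrightarrow> l" using Cauchy_convergent convergent_def by blast
  have lV: "l \<in> V" using V(2) v(1) l closed_sequentially by blast
  have "(\<lambda>n. norm (x - v n)) \<longlonglongrightarrow> norm (x - l)" by (intro tendsto_intros l)
  moreover have "(\<lambda>n. d + 1 / real (Suc n)) \<longlonglongrightarrow> d + 0"
    by (intro tendsto_intros \<open>(\<lambda>n. 1 / real (Suc n)) \<longlonglongrightarrow> 0\<close>)
  ultimately have ld: "norm (x - l) \<le> d"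
    using v(2) by (intro LIMSEQ_le[of _ _ "\<lambda>n. d + 1 / real (Suc n)"]) (auto intro: less_imp_le)
  have "inner (x - l) u = 0" if u: "u \<in> V" for u
  proof (cases "u = 0")
    case False
    \<comment> \<open>The coefficient for which \<open>l + s *\<^sub>R u\<close> is nearest to x
      along the direction u. Minimality of l then leaves no room for a nonzero inner
      product.\<close>
    define s where "s = inner (x - l) u / (norm u)\<^sup>2"
    have "norm (x - l) \<le> norm (x - (l + s *\<^sub>R u))"
      using dle[of "l + s *\<^sub>R u"] ld subspace_add[OF V(1) lV subspace_scale[OF V(1) u]]
      by fastforce
    then have "(norm (x - l))\<^sup>2 \<le> (norm (x - (l + s *\<^sub>R u)))\<^sup>2" by (intro power_mono) auto
    also have "\<dots> = (norm ((x - l) - s *\<^sub>R u))\<^sup>2" by (simp add: algebra_simps)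
    also have "\<dots> = (norm (x - l))\<^sup>2 - 2 * s * inner (x - l) u + s\<^sup>2 * (norm u)\<^sup>2"
      using power2_norm_eq_inner[of "x - l"] power2_norm_eq_inner[of u]
        dot_norm_neg[of "x - l" "s *\<^sub>R u"] by (simp add: power_mult_distrib)
    also have "\<dots> = (norm (x - l))\<^sup>2 - (inner (x - l) u)\<^sup>2 / (norm u)\<^sup>2"
      using False unfolding s_def by (simp add: field_simps power2_eq_square)
    finally have "(inner (x - l) u)\<^sup>2 / (norm u)\<^sup>2 \<le> 0" by simp
    then show ?thesis using False by (simp add: divide_le_0_iff)
  qed simp
  with lV show ?thesis using that by blast
qed

text \<open>The kernel has codimension one, so a vector \<open>w\<close> orthogonal to it determines
  the functional up to a factor, which the value at \<open>w\<close> fixes.\<close>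

lemma Riesz_representation:
  fixes f :: "'a::{real_inner,banach} \<Rightarrow> real"
  assumes "bounded_linear f"
  obtains z where "\<And>x. f x = inner x z"
proof (cases "\<forall>x. f x = 0")
  case True
  then show ?thesis using that[of 0] by simp
next
  case False
  interpret f: bounded_linear f by fact
  obtain x where x: "f x \<noteq> 0" using False by blast
  define V where "V = {x. f x = 0}"
  have "subspace V" unfolding V_def subspace_def by (auto simp: f.add f.scaleR f.zero)
  moreover have "closed V" unfolding V_def
    by (intro closed_Collect_eq continuous_intros f.continuous_on)
  ultimately obtain v where v: "v \<in> V" "\<And>u. u \<in> V \<Longrightarrow> inner (x - v) u = 0"
    using orthogonal_projection_exists by blast
  define w where "w = x - v"
  have fw: "f w = f x" using v(1) unfolding w_def V_def by (simp add: f.diff)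
  then have w0: "w \<noteq> 0" using x f.zero by metis
  have "f y = inner y ((f w / inner w w) *\<^sub>R w)" for y
  proof -
    have "y - (f y / f w) *\<^sub>R w \<in> V" unfolding V_def using fw x by (simp add: f.diff f.scaleR)
    then have "inner w (y - (f y / f w) *\<^sub>R w) = 0" using v(2) unfolding w_def by blast
    then show ?thesis using w0 fw x by (simp add: inner_diff_right inner_commute field_simps)
  qed
  then show ?thesis using that by blast
qed

text \<open>The lower bound makes the range complete, hence closed. By symmetry a vector orthogonal
  to the range is annihilated by \<open>C\<close>, and the lower bound makes it zero.\<close>

lemma symmetric_bounded_below_bij:
  fixes C :: "'a::{real_inner,banach} \<Rightarrow> 'a"
  assumes C: "bounded_linear C" and sym: "\<And>x y. inner (C x) y = inner x (C y)"
    and c: "0 < c" "\<And>x. c * norm x \<le> norm (C x)"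
  shows "bij C"
proof (rule bijI)
  interpret C: bounded_linear C by fact
  show "inj C" unfolding linear_injective_0[OF C.linear_axioms]
  proof (intro allI impI)
    fix x assume "C x = 0"
    then have "c * norm x \<le> 0" using c(2)[of x] by simp
    then show "x = 0" using c(1) by (simp add: mult_le_0_iff)
  qed
  have sub: "subspace (range C)" by (intro linear_subspace_image C.linear_axioms subspace_UNIV)
  have "complete (range C)"
    using complete_isometric_image[OF c(1) subspace_UNIV C] c(2) complete_UNIV by auto
  then have cl: "closed (range C)" by (rule complete_imp_closed)
  have "x \<in> range C" for x
  proof -
    obtain v where v: "v \<in> range C" "\<And>u. u \<in> range C \<Longrightarrow> inner (x - v) u = 0"
      using orthogonal_projection_exists[OF sub cl] by blast
    have "inner (C (x - v)) (C (x - v)) = 0" unfolding sym by (rule v(2)) simp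
    then have "C (x - v) = 0" by simp
    then have "x - v = 0" using c(2)[of "x - v"] c(1) by (simp add: mult_le_0_iff)
    then show "x \<in> range C" using v(1) by simp
  qed
  then show "surj C" by blast
qed

subsection \<open>Polynomials of an operator\<close>

lemma poly_op_altdef:
  assumes "degree p \<le> n"
  shows "poly_op p A x = (\<Sum>i\<le>n. coeff p i *\<^sub>R (A ^^ i) x)"
  unfolding poly_op_def
  by (rule sum.mono_neutral_left) (use assms in \<open>auto simp: coeff_eq_0\<close>)

lemma poly_op_0 [simp]: "poly_op 0 A x = 0"
  by (simp add: poly_op_def)

lemma poly_op_pCons:
  assumes "linear A"
  shows "poly_op (pCons a p) A x = a *\<^sub>R x + A (poly_op p A x)"
proof -
  have "poly_op (pCons a p) A x = (\<Sum>i\<le>Suc (degree p). coeff (pCons a p) i *\<^sub>R (A ^^ i) x)"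
    by (rule poly_op_altdef) (simp add: degree_pCons_le)
  also have "\<dots> = a *\<^sub>R x + (\<Sum>i\<le>degree p. coeff p i *\<^sub>R A ((A ^^ i) x))"
    by (subst sum.atMost_Suc_shift) simp
  also have "\<dots> = a *\<^sub>R x + A (poly_op p A x)"
    by (simp add: poly_op_def linear_sum[OF assms] linear_scale[OF assms])
  finally show ?thesis .
qed

lemma poly_op_add: "poly_op (p + q) A x = poly_op p A x + poly_op q A x"
  using poly_op_altdef[of "p + q" "max (degree p) (degree q)" A x]
    poly_op_altdef[of p "max (degree p) (degree q)" A x]
    poly_op_altdef[of q "max (degree p) (degree q)" A x] degree_add_le_max[of p q]
  by (simp add: scaleR_add_left sum.distrib)

lemma poly_op_smult: "poly_op (smult c p) A x = c *\<^sub>R poly_op p A x"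
  using poly_op_altdef[of "smult c p" "degree p" A x] poly_op_altdef[of p "degree p" A x]
  by (simp add: degree_smult_le scaleR_sum_right)

lemma poly_op_diff: "poly_op (p - q) A x = poly_op p A x - poly_op q A x"
  using poly_op_add[of p "smult (-1) q" A x] poly_op_smult[of "-1" q A x] by simp

lemma poly_op_const: "linear A \<Longrightarrow> poly_op [:a:] A x = a *\<^sub>R x"
  by (simp add: poly_op_pCons linear_0)

lemma bounded_linear_poly_op:
  assumes "bounded_linear A"
  shows "bounded_linear (poly_op p A)"
proof (induction p)
  case 0
  then show ?case by (simp add: poly_op_def)
next
  case (pCons a p)
  have "bounded_linear (\<lambda>x. a *\<^sub>R x + A (poly_op p A x))"
    by (intro bounded_linear_intros bounded_linear_compose[OF assms] pCons.IH)
  then show ?case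
    by (simp add: poly_op_pCons[OF bounded_linear.linear[OF assms], abs_def])
qed

lemma poly_op_mult:
  assumes "bounded_linear A"
  shows "poly_op (p * q) A x = poly_op p A (poly_op q A x)"
proof (induction p)
  case (pCons a p)
  have lin: "linear A" using assms by (rule bounded_linear.linear)
  have "poly_op (pCons a p * q) A x = poly_op (smult a q + pCons 0 (p * q)) A x" by simp
  also have "\<dots> = a *\<^sub>R poly_op q A x + A (poly_op (p * q) A x)"
    by (simp add: poly_op_add poly_op_smult poly_op_pCons[OF lin])
  finally show ?case using pCons by (simp add: poly_op_pCons[OF lin])
qed simp

text \<open>Used with T = A to commute A with its polynomials, and with two different operators to
  carry functions of T'T or |T| across T, where T' is the adjoint.\<close>

lemma poly_op_intertwine:
  assumes "linear A" "linear A'" "linear T" and "\<And>x. T (A x) = A' (T x)"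
  shows "T (poly_op p A x) = poly_op p A' (T x)"
  by (induction p)
    (simp_all add: poly_op_pCons assms linear_0 linear_add linear_scale)

lemma poly_op_symmetric:
  assumes "linear A" and "\<And>x y. inner (A x) y = inner x (A y)"
  shows "inner (poly_op p A x) y = inner x (poly_op p A y)"
proof (induction p arbitrary: x y)
  case (pCons a p)
  have "A (poly_op p A y) = poly_op p A (A y)"
    by (rule poly_op_intertwine) (auto intro: assms)
  then show ?case using pCons
    by (simp add: poly_op_pCons[OF assms(1)] inner_add_left inner_add_right assms(2))
qed simp

section \<open>Complex scalars and complex linearity\<close>

lemma cinner_scaleC_right: "cinner x (c *\<^sub>C y) = cnj c * cinner x y"
  using cinner_commute[of x "c *\<^sub>C y"] cinner_commute[of x y] by (simp add: cinner_scaleC_left)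

lemma norm_scaleC:
  fixes x :: "'a::complex_inner"
  shows "norm (c *\<^sub>C x) = cmod c * norm x"
proof -
  have "Im (cinner x x) = 0" using arg_cong[OF cinner_commute[of x x], of Im] by simp
  then have "inner (c *\<^sub>C x) (c *\<^sub>C x) = (cmod c)\<^sup>2 * inner x x"
    unfolding inner_eq_Re_cinner cmod_power2
    by (simp add: cinner_scaleC_left cinner_scaleC_right power2_eq_square algebra_simps)
  then show ?thesis by (simp add: norm_eq_sqrt_inner real_sqrt_mult)
qed

lemma bounded_clinear_imp_bounded_linear: "bounded_clinear A \<Longrightarrow> bounded_linear A"
  by (simp add: bounded_clinear_def)

lemma bounded_clinear_scaleC: "bounded_clinear A \<Longrightarrow> A (c *\<^sub>C x) = c *\<^sub>C A x"
  by (simp add: bounded_clinear_def)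

lemma bounded_clinear_poly_op:
  assumes "bounded_clinear A"
  shows "bounded_clinear (poly_op p A)"
proof -
  have "poly_op p A (c *\<^sub>C x) = c *\<^sub>C poly_op p A x" for c x
  proof (induction p)
    case 0
    have "c *\<^sub>C (0::'a) = 0" using scaleC_add_right[of c 0 0] by simp
    then show ?case by simp
  next
    case (pCons a p)
    have "a *\<^sub>R c *\<^sub>C x = c *\<^sub>C a *\<^sub>R x"
      by (simp add: scaleR_eq_scaleC scaleC_scaleC mult.commute)
    then show ?case using pCons assms
      by (simp add: poly_op_pCons bounded_clinear_def bounded_linear.linear scaleC_add_right)
  qed
  then show ?thesis using assms by (simp add: bounded_clinear_def bounded_linear_poly_op)
qed

subsection \<open>The spectrum of a self-adjoint operator\<close>

text \<open>Symmetry in the real inner product suffices: complex linearity and Im <x,y> = Re <x,iy>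
  turn it into the complex identity, see \<open>selfadjoint_cinner\<close>.\<close>

definition selfadjoint :: "('a::complex_inner \<Rightarrow> 'a) \<Rightarrow> bool"
  where "selfadjoint A \<longleftrightarrow> bounded_clinear A \<and> (\<forall>x y. inner (A x) y = inner x (A y))"

lemma selfadjointD:
  assumes "selfadjoint A"
  shows "bounded_clinear A" "bounded_linear A" "linear A" "inner (A x) y = inner x (A y)"
  using assms unfolding selfadjoint_def bounded_clinear_def by (auto intro: bounded_linear.linear)

lemma selfadjoint_poly_op: "selfadjoint A \<Longrightarrow> selfadjoint (poly_op p A)"
  unfolding selfadjoint_def[of "poly_op p A"]
  by (intro conjI allI bounded_clinear_poly_op poly_op_symmetric selfadjointD)

abbreviation real_spectrum :: "('a::complex_inner \<Rightarrow> 'a) \<Rightarrow> real set"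
  where "real_spectrum A \<equiv> {r. complex_of_real r \<in> op_spectrum A}"

lemma bounded_below_off_spectrum:
  assumes "r \<notin> real_spectrum A"
  obtains c where "0 < c" "\<And>x. c * norm x \<le> norm (A x - r *\<^sub>R x)"
proof -
  obtain S where S: "bounded_clinear S" "\<And>x. S (A x - r *\<^sub>R x) = x"
    using assms unfolding op_spectrum_def scaleR_eq_scaleC by blast
  have bl: "bounded_linear S" using S(1) by (rule bounded_clinear_imp_bounded_linear)
  \<comment> \<open>The summand 1 keeps the constant finite and positive even when
    \<open>onorm S = 0\<close>, as on the zero space.\<close>
  have pos: "0 < onorm S + 1" using onorm_pos_le[OF bl] by simp
  have "1 / (onorm S + 1) * norm x \<le> norm (A x - r *\<^sub>R x)" for x
  proof -
    have "norm x \<le> onorm S * norm (A x - r *\<^sub>R x)" using onorm[OF bl, of "A x - r *\<^sub>R x"] S(2) by simp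
    also have "\<dots> \<le> (onorm S + 1) * norm (A x - r *\<^sub>R x)" by (intro mult_right_mono) auto
    finally show ?thesis using pos by (simp add: field_simps)
  qed
  then show ?thesis using that pos by (meson zero_less_divide_1_iff)
qed

text \<open>\<open>A - r\<close> is again symmetric, so the lower bound yields bijectivity, and the
  same bound makes the inverse bounded by 1/c. This is what excludes real numbers from the
  spectrum.\<close>

lemma off_spectrum_if_bounded_below:
  fixes A :: "'a::complex_hilbert_space \<Rightarrow> 'a"
  assumes A: "selfadjoint A"
    and c: "0 < c" "\<And>x. c * norm x \<le> norm (A x - r *\<^sub>R x)"
  shows "r \<notin> real_spectrum A"
proof -
  define C where "C x = A x - r *\<^sub>R x" for x
  have C: "bounded_linear C" unfolding C_def
    by (intro bounded_linear_sub selfadjointD(2)[OF A] bounded_linear_intros)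
  interpret C: bounded_linear C by fact
  have CC: "C (a *\<^sub>C x) = a *\<^sub>C C x" for a x
  proof -
    have "a *\<^sub>C (A x) = a *\<^sub>C C x + a *\<^sub>C r *\<^sub>R x"
      by (simp add: C_def flip: scaleC_add_right)
    then show ?thesis
      by (simp add: C_def bounded_clinear_scaleC[OF selfadjointD(1)[OF A]] scaleR_eq_scaleC
          scaleC_scaleC mult.commute)
  qed
  have bij: "bij C"
    by (rule symmetric_bounded_below_bij[OF C _ c(1)])
      (use c(2) in \<open>auto simp: C_def inner_diff_left inner_diff_right selfadjointD(4)[OF A]\<close>)
  define S where "S = inv C"
  have CS: "C (S x) = x" and SC: "S (C x) = x" for x
    using bij unfolding S_def by (auto simp: bij_def surj_f_inv_f)
  have eqI: "x = y" if "C x = C y" for x y using arg_cong[OF that, of S] by (simp only: SC)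
  have "bounded_linear S"
  proof (rule bounded_linear_intro[where K = "1 / c"])
    show "norm (S x) \<le> norm x * (1 / c)" for x
    proof -
      have "c * norm (S x) \<le> norm (C (S x))" using c(2) by (simp add: C_def)
      then show ?thesis using c(1) by (simp add: CS field_simps)
    qed
  qed (rule eqI, simp add: CS C.add C.scaleR)+
  moreover have "S (a *\<^sub>C x) = a *\<^sub>C S x" for a x
    by (rule eqI) (simp add: CS CC)
  ultimately have "bounded_clinear S" by (simp add: bounded_clinear_def)
  then show ?thesis using CS SC unfolding op_spectrum_def scaleR_eq_scaleC C_def by auto
qed

section \<open>Factors of real polynomials and lower bounds for polynomials of an operator\<close>

lemma map_poly_of_real_add:
  "map_poly of_real (p + q) = map_poly of_real p + (map_poly of_real q :: 'a::real_normed_algebra_1 poly)"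
  by (rule poly_eqI) (simp add: coeff_map_poly)

lemma map_poly_of_real_mult:
  "map_poly of_real (p * q)
    = map_poly of_real p * (map_poly of_real q :: 'a::{real_normed_algebra_1,comm_ring_1} poly)"
  by (rule poly_eqI) (simp add: coeff_map_poly coeff_mult)

lemma poly_map_poly_of_real:
  "poly (map_poly of_real p) (of_real r) = (of_real (poly p r) :: 'a::{real_normed_algebra_1,comm_ring_1})"
  by (induction p) (simp_all add: map_poly_pCons)

text \<open>The quadratic is (X - z)(X - cnj z). The remainder modulo it is a real polynomial e + fX
  vanishing at a nonreal point, which forces f = 0 and then e = 0.\<close>

lemma real_quadratic_dvd:
  fixes q :: "real poly"
  assumes z: "poly (map_poly of_real q) z = 0" and im: "Im z \<noteq> 0"
  shows "[:(Re z)\<^sup>2 + (Im z)\<^sup>2, - 2 * Re z, 1:] dvd q"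
proof -
  let ?d = "[:(Re z)\<^sup>2 + (Im z)\<^sup>2, - 2 * Re z, 1:]"
  let ?ev = "\<lambda>p. poly (map_poly complex_of_real p) z"
  have ev_d: "?ev ?d = 0"
    by (simp add: map_poly_pCons complex_eq_iff algebra_simps power2_eq_square)
  have "degree (q mod ?d) < 2"
    using degree_mod_less[of ?d q] by auto
  then have "q mod ?d = [:coeff (q mod ?d) 0, coeff (q mod ?d) 1:]"
    by (intro poly_eqI) (auto simp: coeff_pCons coeff_eq_0 split: nat.split)
  then obtain e f where ef: "q mod ?d = [:e, f:]" by blast
  have "?ev q = ?ev (q div ?d * ?d + q mod ?d)" by (simp only: div_mult_mod_eq)
  also have "\<dots> = ?ev (q mod ?d)"
    unfolding map_poly_of_real_add map_poly_of_real_mult poly_add poly_mult ev_d by simp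
  finally have "complex_of_real e + z * complex_of_real f = 0"
    using z unfolding ef by (simp add: map_poly_pCons)
  then have "e + Re z * f = 0" "Im z * f = 0" by (simp_all add: complex_eq_iff)
  then have "f = 0" "e = 0" using im by simp_all
  then show ?thesis using ef by (simp add: mod_eq_0_iff_dvd)
qed

text \<open>A nonreal root \<open>a + b\<i>\<close> contributes the factor \<open>(A - a)\<^sup>2 + b\<^sup>2 \<ge> b\<^sup>2\<close>.\<close>

lemma poly_op_bounded_below:
  fixes A :: "'a::complex_inner \<Rightarrow> 'a"
  assumes A: "selfadjoint A" and "q \<noteq> 0" and "\<And>r. r \<in> real_spectrum A \<Longrightarrow> poly q r \<noteq> 0"
  shows "\<exists>c>0. \<forall>x. c * norm x \<le> norm (poly_op q A x)"
  using assms(2,3)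
proof (induction "degree q" arbitrary: q rule: less_induct)
  case less
  note bl = selfadjointD(2)[OF A] and lin = selfadjointD(3)[OF A]
  \<comment> \<open>Lower bounds multiply under composition. It is therefore enough to split off one
    nonconstant factor that is bounded below at \<open>A\<close>; the cofactor has smaller degree
    and inherits the absence of roots in the spectrum.\<close>
  have step: ?case if d: "q = d * m" and deg: "degree d \<noteq> 0"
    and low: "\<exists>c>0. \<forall>x. c * norm x \<le> norm (poly_op d A x)" for d m
  proof -
    have nz: "m \<noteq> 0" "d \<noteq> 0" using d \<open>q \<noteq> 0\<close> by auto
    then have "degree m < degree q" using d deg by (simp add: degree_mult_eq)
    then obtain c' where c': "0 < c'" "\<And>x. c' * norm x \<le> norm (poly_op m A x)"
      using less.hyps[of m] less.prems(2) nz d by auto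
    obtain c where c: "0 < c" "\<And>x. c * norm x \<le> norm (poly_op d A x)" using low by blast
    have "c * c' * norm x \<le> norm (poly_op q A x)" for x
    proof -
      have "c * (c' * norm x) \<le> c * norm (poly_op m A x)"
        using c' c(1) by (intro mult_left_mono) auto
      also have "\<dots> \<le> norm (poly_op q A x)" using c(2) by (simp add: d poly_op_mult[OF bl])
      finally show ?thesis by (simp add: mult.assoc)
    qed
    then show ?case using c(1) c'(1) by (meson mult_pos_pos)
  qed
  show ?case
  proof (cases "degree q = 0")
    case True
    then obtain a where "q = [:a:]" by (meson degree_eq_zeroE)
    then show ?thesis using \<open>q \<noteq> 0\<close>
      by (intro exI[of _ "\<bar>a\<bar>"]) (simp add: poly_op_const[OF lin])
  next
    case False
    let ?Q = "map_poly complex_of_real q"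
    have "degree ?Q \<noteq> 0" using False by (simp add: degree_map_poly)
    then obtain z where z: "poly ?Q z = 0"
      using fundamental_theorem_of_algebra constant_degree by metis
    show ?thesis
    proof (cases "Im z = 0")
      case True
      then have "complex_of_real (Re z) = z" by (simp add: complex_eq_iff)
      then have "complex_of_real (poly q (Re z)) = poly ?Q z"
        by (metis poly_map_poly_of_real)
      then have root: "poly q (Re z) = 0" using z by simp
      then obtain m where m: "q = [:- Re z, 1:] * m" by (meson poly_eq_0_iff_dvd dvdE)
      have "Re z \<notin> real_spectrum A" using root less.prems(2) by blast
      then have "\<exists>c>0. \<forall>x. c * norm x \<le> norm (poly_op [:- Re z, 1:] A x)"
        by (elim bounded_below_off_spectrum)
          (auto simp: poly_op_pCons[OF lin] linear_0[OF lin])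
      then show ?thesis by (intro step[OF m]) auto
    next
      case im: False
      let ?d = "[:(Re z)\<^sup>2 + (Im z)\<^sup>2, - 2 * Re z, 1:]"
      obtain m where m: "q = ?d * m" using real_quadratic_dvd[OF z im] by (elim dvdE)
      have "(Im z)\<^sup>2 * norm x \<le> norm (poly_op ?d A x)" for x
      proof (cases "x = 0")
        case False
        have "poly_op ?d A x = ((Re z)\<^sup>2 + (Im z)\<^sup>2) *\<^sub>R x - (2 * Re z) *\<^sub>R A x + A (A x)"
          by (simp add: poly_op_pCons[OF lin] linear_0[OF lin] linear_add[OF lin]
              linear_diff[OF lin] linear_neg[OF lin] linear_scale[OF lin])
        moreover have "(norm (A x - Re z *\<^sub>R x))\<^sup>2
            = inner (A (A x)) x - 2 * Re z * inner (A x) x + (Re z)\<^sup>2 * inner x x"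
          unfolding power2_norm_eq_inner power2_eq_square[of "Re z"]
          by (simp add: inner_diff_left inner_diff_right selfadjointD(4)[OF A, of "A x" x]
              selfadjointD(4)[OF A, of x x] algebra_simps)
        ultimately have "inner (poly_op ?d A x) x
            = (norm (A x - Re z *\<^sub>R x))\<^sup>2 + (Im z)\<^sup>2 * inner x x"
          by (simp only: inner_diff_left inner_add_left inner_scaleR_left) (simp add: distrib_right)
        then have "(Im z)\<^sup>2 * inner x x \<le> inner (poly_op ?d A x) x" by simp
        also have "\<dots> \<le> norm (poly_op ?d A x) * norm x" by (rule norm_cauchy_schwarz)
        finally have "((Im z)\<^sup>2 * norm x) * norm x \<le> norm (poly_op ?d A x) * norm x"
          by (simp only: dot_square_norm power2_eq_square[of "norm x"] mult.assoc)
        then show ?thesis using False by simp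
      qed simp
      moreover have "0 < (Im z)\<^sup>2" using im by simp
      ultimately have "\<exists>c>0. \<forall>x. c * norm x \<le> norm (poly_op ?d A x)" by blast
      then show ?thesis by (intro step[OF m]) simp_all
    qed
  qed
qed

text \<open>With N the norm, N or -N is an approximate eigenvalue of a symmetric operator; squaring
  avoids the choice of sign. Expanding |S^2 x - N^2 x|^2 and using |S^2 x| \<le> N |S x| bounds it
  by N^2 (N^2 |x|^2 - |S x|^2), so a positive lower bound would make N too large a constant for
  \<open>S\<close>.\<close>

lemma onorm_not_bounded_below:
  fixes S :: "'a::real_inner \<Rightarrow> 'a"
  assumes S: "bounded_linear S" and sym: "\<And>x y. inner (S x) y = inner x (S y)"
    and "\<exists>x::'a. x \<noteq> 0" and "0 < c"
  shows "\<exists>x. norm (S (S x) - (onorm S)\<^sup>2 *\<^sub>R x) < c * norm x"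
proof (rule ccontr)
  assume "\<not> ?thesis"
  then have low: "c * norm x \<le> norm (S (S x) - (onorm S)\<^sup>2 *\<^sub>R x)" for x
    by (simp add: not_less)
  interpret S: bounded_linear S by fact
  let ?N = "onorm S"
  have N0: "0 \<le> ?N" by (rule onorm_pos_le[OF S])
  have est: "c\<^sup>2 * (norm x)\<^sup>2 \<le> ?N\<^sup>2 * (?N\<^sup>2 * (norm x)\<^sup>2 - (norm (S x))\<^sup>2)" for x
  proof -
    have "(c * norm x)\<^sup>2 \<le> (norm (S (S x) - ?N\<^sup>2 *\<^sub>R x))\<^sup>2"
      using low \<open>0 < c\<close> by (intro power_mono) auto
    also have "\<dots> = (norm (S (S x)))\<^sup>2 - 2 * ?N\<^sup>2 * (norm (S x))\<^sup>2 + ?N^4 * (norm x)\<^sup>2"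
      using power2_norm_eq_inner[of "S x"] power2_norm_eq_inner[of x] sym[of "S x" x]
        dot_norm_neg[of "S (S x)" "?N\<^sup>2 *\<^sub>R x"] by (simp add: power_mult_distrib)
    also have "(norm (S (S x)))\<^sup>2 \<le> (?N * norm (S x))\<^sup>2"
      by (intro power_mono onorm[OF S]) auto
    finally show ?thesis by (simp add: power_mult_distrib algebra_simps flip: power_add)
  qed
  obtain y :: 'a where y: "y \<noteq> 0" using assms(3) by blast
  have "0 < c\<^sup>2 * (norm y)\<^sup>2" using y \<open>0 < c\<close> by simp
  then have Npos: "0 < ?N" using est[of y] N0 by (cases "?N = 0") auto
  \<comment> \<open>The constant that results from dividing \<open>est\<close> by N^2; its square
    root would be a bound for \<open>S\<close> below the norm.\<close>
  define b where "b = ?N\<^sup>2 - c\<^sup>2 / ?N\<^sup>2"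
  have b: "(norm (S x))\<^sup>2 \<le> b * (norm x)\<^sup>2" for x
    using est[of x] Npos by (simp add: b_def field_simps)
  have "0 \<le> b" using b[of y] y zero_le_power2[of "norm (S y)"]
    by (smt (verit) mult_neg_pos norm_eq_zero zero_less_power2)
  have "norm (S x) \<le> sqrt b * norm x" for x
    using real_sqrt_le_mono[OF b[of x]] by (simp add: real_sqrt_mult)
  then have "?N \<le> sqrt b" by (intro onorm_bound) (use \<open>0 \<le> b\<close> in auto)
  then have "?N\<^sup>2 \<le> (sqrt b)\<^sup>2" using N0 by (intro power_mono)
  then have "?N\<^sup>2 \<le> b" using \<open>0 \<le> b\<close> by simp
  moreover have "0 < c\<^sup>2 / ?N\<^sup>2" using Npos \<open>0 < c\<close> by simp
  ultimately show False by (simp add: b_def)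
qed

text \<open>On an empty spectrum X^2 - |A|^2 would have no roots and hence be bounded below at
  \<open>A\<close>. A spectral point is needed in the norm bound that follows, to see that the
  polynomial used there is not the zero polynomial.\<close>

lemma real_spectrum_nonempty:
  fixes A :: "'a::complex_inner \<Rightarrow> 'a"
  assumes A: "selfadjoint A" and "\<exists>x::'a. x \<noteq> 0"
  shows "real_spectrum A \<noteq> {}"
proof
  assume "real_spectrum A = {}"
  let ?q = "[:- (onorm A)\<^sup>2, 0, 1:] :: real poly"
  obtain c where c: "c > 0" "\<And>x. c * norm x \<le> norm (poly_op ?q A x)"
    using poly_op_bounded_below[OF A, of ?q] \<open>real_spectrum A = {}\<close> by auto
  obtain x where "norm (A (A x) - (onorm A)\<^sup>2 *\<^sub>R x) < c * norm x"
    using onorm_not_bounded_below[of A c] selfadjointD[OF A] assms(2) c(1) by blast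
  with c(2)[of x] show False
    by (simp add: poly_op_pCons[OF selfadjointD(3)[OF A]] linear_0[OF selfadjointD(3)[OF A]])
qed

lemma norm_poly_op_le:
  fixes A :: "'a::complex_inner \<Rightarrow> 'a"
  assumes A: "selfadjoint A" and "0 \<le> m" and m: "\<And>r. r \<in> real_spectrum A \<Longrightarrow> \<bar>poly p r\<bar> \<le> m"
  shows "norm (poly_op p A x) \<le> m * norm x"
proof (cases "x = 0")
  case True
  then show ?thesis
    using bounded_linear.linear[OF bounded_linear_poly_op[OF selfadjointD(2)[OF A], of p]]
    by (simp add: linear_0)
next
  case False
  let ?S = "poly_op p A"
  have S: "selfadjoint ?S" by (rule selfadjoint_poly_op[OF A])
  \<comment> \<open>At \<open>A\<close> this polynomial is S^2 - |S|^2. If |S| exceeded m, it would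
    be negative throughout the spectrum, because p^2 \<le> m^2 there.\<close>
  let ?q = "p * p - [:(onorm ?S)\<^sup>2:]"
  have "onorm ?S \<le> m"
  proof (rule ccontr)
    assume "\<not> onorm ?S \<le> m"
    then have "m\<^sup>2 < (onorm ?S)\<^sup>2" using \<open>0 \<le> m\<close> by (intro power_strict_mono) auto
    then have q: "poly ?q r \<noteq> 0" if "r \<in> real_spectrum A" for r
      using power_mono[OF m[OF that], of 2] by (auto simp: power2_eq_square)
    moreover have "?q \<noteq> 0" using real_spectrum_nonempty[OF A] False q by force
    ultimately obtain c where c: "c > 0" "\<And>x. c * norm x \<le> norm (poly_op ?q A x)"
      using poly_op_bounded_below[OF A, of ?q] by blast
    obtain x where "norm (?S (?S x) - (onorm ?S)\<^sup>2 *\<^sub>R x) < c * norm x"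
      using onorm_not_bounded_below[of ?S c] selfadjointD[OF S] False c(1) by blast
    with c(2)[of x] show False
      by (simp add: poly_op_diff poly_op_mult poly_op_const selfadjointD[OF A])
  qed
  then show ?thesis
    using onorm[OF selfadjointD(2)[OF S], of x] mult_right_mono[of "onorm ?S" m "norm x"] by simp
qed

subsection \<open>Continuous functional calculus\<close>

lemma Weierstrass_poly_uniform_limit:
  fixes f :: "real \<Rightarrow> real"
  assumes "continuous_on {a..b} f"
  obtains p :: "nat \<Rightarrow> real poly" where "uniform_limit {a..b} (\<lambda>n. poly (p n)) f sequentially"
proof -
  have "\<exists>p. \<forall>x\<in>{a..b}. \<bar>f x - poly p x\<bar> < 1 / Suc n" for n
  proof -
    obtain g where g: "real_polynomial_function g" "\<And>x. x \<in> {a..b} \<Longrightarrow> \<bar>f x - g x\<bar> < 1 / Suc n"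
      using Stone_Weierstrass_real_polynomial_function[OF _ assms, of "1 / Suc n"] by auto
    then obtain c k where "g = (\<lambda>x. \<Sum>i\<le>k. c i * x ^ i)"
      unfolding real_polynomial_function_iff_sum by blast
    then have "g = poly (\<Sum>i\<le>k. monom (c i) i)" by (simp add: poly_sum poly_monom fun_eq_iff)
    then show ?thesis using g(2) by blast
  qed
  then obtain p where p: "\<And>n x. x \<in> {a..b} \<Longrightarrow> \<bar>f x - poly (p n) x\<bar> < 1 / Suc n" by metis
  have "uniform_limit {a..b} (\<lambda>n. poly (p n)) f sequentially"
  proof (rule uniform_limitI)
    fix e :: real assume "0 < e"
    then have "\<forall>\<^sub>F n in sequentially. 1 / real (Suc n) < e"
      using order_tendstoD(2)[OF LIMSEQ_inverse_real_of_nat, of e] by (simp add: inverse_eq_divide)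
    then show "\<forall>\<^sub>F n in sequentially. \<forall>x\<in>{a..b}. dist (poly (p n) x) (f x) < e"
    proof eventually_elim
      case (elim n)
      show ?case
      proof
        fix x assume "x \<in> {a..b}"
        then show "dist (poly (p n) x) (f x) < e"
          using p[of x n] elim by (simp add: dist_norm abs_minus_commute)
      qed
    qed
  qed
  then show ?thesis by (rule that)
qed

text \<open>Two sequences are compared at once: p = q gives the Cauchy property, and different ones
  show that the limit does not depend on the approximating sequence.\<close>

lemma poly_op_uniform_Cauchy:
  assumes A: "selfadjoint A"
    and p: "uniform_limit (real_spectrum A) (\<lambda>n. poly (p n)) f sequentially"
    and q: "uniform_limit (real_spectrum A) (\<lambda>n. poly (q n)) f sequentially"
    and "0 < e"
  shows "\<exists>N. \<forall>m\<ge>N. \<forall>n\<ge>N. \<forall>x. norm (poly_op (p m) A x - poly_op (q n) A x) \<le> e * norm x"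
proof -
  have "\<forall>\<^sub>F n in sequentially. (\<forall>r\<in>real_spectrum A. dist (poly (p n) r) (f r) < e / 2)
      \<and> (\<forall>r\<in>real_spectrum A. dist (poly (q n) r) (f r) < e / 2)"
    using \<open>0 < e\<close> by (intro eventually_conj uniform_limitD[OF p] uniform_limitD[OF q]) auto
  then obtain N where N: "\<And>n r. N \<le> n \<Longrightarrow> r \<in> real_spectrum A \<Longrightarrow> dist (poly (p n) r) (f r) < e / 2"
      "\<And>n r. N \<le> n \<Longrightarrow> r \<in> real_spectrum A \<Longrightarrow> dist (poly (q n) r) (f r) < e / 2"
    unfolding eventually_sequentially by blast
  have "norm (poly_op (p m) A x - poly_op (q n) A x) \<le> e * norm x" if "N \<le> m" "N \<le> n" for m n x
    unfolding poly_op_diff[symmetric]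
  proof (rule norm_poly_op_le[OF A])
    show "\<bar>poly (p m - q n) r\<bar> \<le> e" if "r \<in> real_spectrum A" for r
      using N(1)[OF \<open>N \<le> m\<close> that] N(2)[OF \<open>N \<le> n\<close> that]
      unfolding dist_norm real_norm_def poly_diff by linarith
  qed (use \<open>0 < e\<close> in simp)
  then show ?thesis by blast
qed

lemma cont_fun_calc_exists:
  fixes A :: "'a::complex_hilbert_space \<Rightarrow> 'a"
  assumes A: "selfadjoint A"
    and p: "uniform_limit (real_spectrum A) (\<lambda>n. poly (p n)) f sequentially"
  obtains B where "bounded_clinear B"
    "\<And>q. uniform_limit (real_spectrum A) (\<lambda>n. poly (q n)) f sequentially
      \<Longrightarrow> (\<lambda>n. onorm (\<lambda>x. poly_op (q n) A x - B x)) \<longlonglongrightarrow> 0"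
proof -
  note bcl = bounded_clinear_poly_op[OF selfadjointD(1)[OF A]]
  note bl = bounded_clinear_imp_bounded_linear[OF bcl]
  have "Cauchy (\<lambda>n. poly_op (p n) A x)" for x
  proof (rule CauchyI)
    fix e :: real assume e: "0 < e"
    have "e * norm x < e * (norm x + 1)" using e by simp
    then have "e / (norm x + 1) * norm x < e"
      by (simp add: pos_divide_less_eq add_nonneg_pos)
    then show "\<exists>N. \<forall>m\<ge>N. \<forall>n\<ge>N. norm (poly_op (p m) A x - poly_op (p n) A x) < e"
      using poly_op_uniform_Cauchy[OF A p p, of "e / (norm x + 1)"] e
      by (meson divide_pos_pos add_nonneg_pos norm_ge_zero zero_less_one order_le_less_trans)
  qed
  moreover define B where "B x = lim (\<lambda>n. poly_op (p n) A x)" for x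
  ultimately have B: "(\<lambda>n. poly_op (p n) A x) \<longlonglongrightarrow> B x" for x
    unfolding B_def using Cauchy_convergent convergent_LIMSEQ_iff by blast
  \<comment> \<open>The estimate is uniform in x, which upgrades pointwise convergence to
    convergence of \<open>onorm\<close>. It covers every q because the description of
    \<open>cont_fun_calc\<close> quantifies over all approximating sequences.\<close>
  have near: "\<exists>N. \<forall>n\<ge>N. \<forall>x. norm (poly_op (q n) A x - B x) \<le> e * norm x"
    if q: "uniform_limit (real_spectrum A) (\<lambda>n. poly (q n)) f sequentially" and "0 < e" for q e
  proof -
    obtain N where N: "\<And>m n x. N \<le> m \<Longrightarrow> N \<le> n \<Longrightarrow>
        norm (poly_op (q n) A x - poly_op (p m) A x) \<le> e * norm x"
      using poly_op_uniform_Cauchy[OF A q p \<open>0 < e\<close>] by blast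
    have "norm (poly_op (q n) A x - B x) \<le> e * norm x" if "N \<le> n" for n x
    proof (rule LIMSEQ_le_const2)
      show "(\<lambda>m. norm (poly_op (q n) A x - poly_op (p m) A x)) \<longlonglongrightarrow> norm (poly_op (q n) A x - B x)"
        by (intro tendsto_intros B)
    qed (use N that in blast)
    then show ?thesis by blast
  qed
  have "linear B"
  proof (rule linearI)
    fix x y and r :: real
    have "(\<lambda>n. poly_op (p n) A x + poly_op (p n) A y) \<longlonglongrightarrow> B x + B y" by (intro tendsto_intros B)
    then show "B (x + y) = B x + B y"
      using B[of "x + y"] by (auto simp: bounded_linear.linear[OF bl] linear_add intro: LIMSEQ_unique)
    have "(\<lambda>n. r *\<^sub>R poly_op (p n) A x) \<longlonglongrightarrow> r *\<^sub>R B x" by (intro tendsto_intros B)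
    then show "B (r *\<^sub>R x) = r *\<^sub>R B x"
      using B[of "r *\<^sub>R x"]
      by (auto simp: bounded_linear.linear[OF bl] linear_scale intro: LIMSEQ_unique)
  qed
  moreover obtain N where N: "\<And>x. norm (poly_op (p N) A x - B x) \<le> 1 * norm x"
    using near[OF p, of 1] by auto
  have "norm (B x) \<le> norm x * (onorm (poly_op (p N) A) + 1)" for x
  proof -
    have "norm (B x) \<le> norm (poly_op (p N) A x) + norm (poly_op (p N) A x - B x)"
      by (metis norm_triangle_sub norm_minus_commute add.commute)
    then show ?thesis using N[of x] onorm[OF bl, of "p N" x] by (simp add: algebra_simps)
  qed
  ultimately have blB: "bounded_linear B"
    by (intro bounded_linear_intro[of B "onorm (poly_op (p N) A) + 1"]) (auto simp: linear_add linear_scale)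
  have "B (c *\<^sub>C x) = c *\<^sub>C B x" for c x
  proof (rule LIMSEQ_unique[OF B])
    have "bounded_linear (\<lambda>v::'a. c *\<^sub>C v)"
    proof (rule bounded_linear_intro)
      show "norm (c *\<^sub>C v) \<le> norm v * cmod c" for v :: 'a by (simp add: norm_scaleC mult.commute)
    qed (simp_all add: scaleC_add_right scaleR_eq_scaleC scaleC_scaleC mult.commute)
    then show "(\<lambda>n. poly_op (p n) A (c *\<^sub>C x)) \<longlonglongrightarrow> c *\<^sub>C B x"
      unfolding bounded_clinear_scaleC[OF bcl] using B by (rule bounded_linear.tendsto)
  qed
  then have "bounded_clinear B" using blB by (simp add: bounded_clinear_def)
  moreover have "(\<lambda>n. onorm (\<lambda>x. poly_op (q n) A x - B x)) \<longlonglongrightarrow> 0"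
    if q: "uniform_limit (real_spectrum A) (\<lambda>n. poly (q n)) f sequentially" for q
  proof (rule LIMSEQ_I)
    fix e :: real assume e: "0 < e"
    obtain N where N: "\<And>n x. N \<le> n \<Longrightarrow> norm (poly_op (q n) A x - B x) \<le> (e / 2) * norm x"
      using near[OF q, of "e / 2"] e by auto
    have "norm (onorm (\<lambda>x. poly_op (q n) A x - B x) - 0) < e" if "N \<le> n" for n
      using onorm_bound[of "e / 2" "\<lambda>x. poly_op (q n) A x - B x"] N[OF that] e
        onorm_pos_le[OF bounded_linear_sub[OF bl blB], of "q n"] by simp
    then show "\<exists>N. \<forall>n\<ge>N. norm (onorm (\<lambda>x. poly_op (q n) A x - B x) - 0) < e" by blast
  qed
  ultimately show ?thesis by (rule that)
qed

lemma tendsto_of_onorm: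
  assumes "\<And>n. bounded_linear (S n)" "bounded_linear B" "(\<lambda>n. onorm (\<lambda>x. S n x - B x)) \<longlonglongrightarrow> 0"
  shows "(\<lambda>n. S n x) \<longlonglongrightarrow> B x"
proof (rule LIM_zero_cancel, rule Lim_null_comparison)
  show "\<forall>\<^sub>F n in sequentially. norm (S n x - B x) \<le> onorm (\<lambda>x. S n x - B x) * norm x"
    by (intro always_eventually allI onorm bounded_linear_sub assms)
  show "(\<lambda>n. onorm (\<lambda>x. S n x - B x) * norm x) \<longlonglongrightarrow> 0"
    by (rule tendsto_mult_left_zero) (rule assms(3))
qed

text \<open>The sequence \<open>p\<close> secures uniqueness as well as existence: every candidate
  for the definite description is the pointwise limit of \<open>poly_op (p n) A\<close>.\<close>

lemma cont_fun_calc_limit: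
  fixes A :: "'a::complex_hilbert_space \<Rightarrow> 'a"
  assumes A: "selfadjoint A"
    and p: "uniform_limit (real_spectrum A) (\<lambda>n. poly (p n)) f sequentially"
  shows "bounded_clinear (cont_fun_calc f A)"
    and "(\<lambda>n. poly_op (p n) A x) \<longlonglongrightarrow> cont_fun_calc f A x"
proof -
  let ?P = "\<lambda>B. bounded_clinear B \<and> (\<forall>p.
      uniform_limit (real_spectrum A) (\<lambda>n. poly (p n)) f sequentially \<longrightarrow>
      (\<lambda>n. onorm (\<lambda>x. poly_op (p n) A x - B x)) \<longlonglongrightarrow> 0)"
  note bl = bounded_linear_poly_op[OF selfadjointD(2)[OF A]]
  have lim: "(\<lambda>n. poly_op (p n) A x) \<longlonglongrightarrow> B x" if "?P B" for B x
    by (rule tendsto_of_onorm[of "\<lambda>n. poly_op (p n) A" B])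
      (use that p bl in \<open>auto simp: bounded_clinear_def\<close>)
  obtain B where B: "?P B" by (rule cont_fun_calc_exists[OF A p]) blast
  have "?P (cont_fun_calc f A)" unfolding cont_fun_calc_def
  proof (rule theI[of ?P])
    show "B' = B" if "?P B'" for B'
      using LIMSEQ_unique[OF lim[OF that] lim[OF B]] by blast
  qed (rule B)
  then show "bounded_clinear (cont_fun_calc f A)" "(\<lambda>n. poly_op (p n) A x) \<longlonglongrightarrow> cont_fun_calc f A x"
    using lim by blast+
qed

text \<open>The bound M is a free parameter rather than the norm, so that two operators can share
  the interval \<open>{0..M}\<close> and one approximating sequence on it.\<close>

definition positive_upto :: "real \<Rightarrow> ('a::complex_inner \<Rightarrow> 'a) \<Rightarrow> bool"
  where "positive_upto M A \<longleftrightarrow> selfadjoint A \<and> (\<forall>x. 0 \<le> inner (A x) x) \<and> onorm A \<le> M"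

lemma positive_uptoD: "positive_upto M A \<Longrightarrow> selfadjoint A"
  by (simp add: positive_upto_def)

text \<open>Outside the interval \<open>A - r\<close> is bounded below: for r < 0 by -r, from its
  quadratic form, and for r > M by r - M, from the triangle inequality.\<close>

lemma real_spectrum_positive_upto:
  fixes A :: "'a::complex_hilbert_space \<Rightarrow> 'a"
  assumes A: "positive_upto M A"
  shows "real_spectrum A \<subseteq> {0..M}"
proof
  fix r assume r: "r \<in> real_spectrum A"
  note sa = positive_uptoD[OF A]
  have "0 \<le> r"
  proof (rule ccontr)
    assume neg: "\<not> 0 \<le> r"
    have "- r * norm x \<le> norm (A x - r *\<^sub>R x)" for x
    proof (cases "x = 0")
      case False
      have "- r * (norm x * norm x) \<le> inner (A x - r *\<^sub>R x) x"
        using A by (simp add: positive_upto_def inner_diff_left dot_square_norm power2_eq_square)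
      also have "\<dots> \<le> norm (A x - r *\<^sub>R x) * norm x" by (rule norm_cauchy_schwarz)
      finally have "(- r * norm x) * norm x \<le> norm (A x - r *\<^sub>R x) * norm x" by (simp add: mult.assoc)
      then show ?thesis using False by (simp only: mult_le_cancel_right) simp
    qed simp
    then show False using off_spectrum_if_bounded_below[OF sa, of "- r" r] neg r by simp
  qed
  moreover have "r \<le> M"
  proof (rule ccontr)
    assume big: "\<not> r \<le> M"
    have "(r - M) * norm x \<le> norm (A x - r *\<^sub>R x)" for x
    proof -
      have "norm (A x) \<le> onorm A * norm x" using onorm selfadjointD(2)[OF sa] by blast
      also have "\<dots> \<le> M * norm x" using A by (intro mult_right_mono) (auto simp: positive_upto_def)
      finally have "norm (A x) \<le> M * norm x" .
      moreover have "r * norm x \<le> norm (r *\<^sub>R x)" by (simp add: mult_right_mono)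
      ultimately show ?thesis
        using norm_triangle_ineq2[of "r *\<^sub>R x" "A x"] by (simp add: norm_minus_commute algebra_simps)
    qed
    then show False using off_spectrum_if_bounded_below[OF sa, of "r - M" r] big r by simp
  qed
  ultimately show "r \<in> {0..M}" by simp
qed

context
  fixes A :: "'a::complex_hilbert_space \<Rightarrow> 'a" and M :: real
  assumes A: "positive_upto M A"
begin

lemma fun_calc_tendsto:
  assumes "uniform_limit {0..M} (\<lambda>n. poly (p n)) f sequentially"
  shows "(\<lambda>n. poly_op (p n) A x) \<longlonglongrightarrow> cont_fun_calc f A x"
  using cont_fun_calc_limit(2)[OF positive_uptoD[OF A]]
    uniform_limit_on_subset[OF assms real_spectrum_positive_upto[OF A]] by blast

lemma fun_calc_poly: "cont_fun_calc (poly p) A x = poly_op p A x"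
  using fun_calc_tendsto[OF uniform_limit_const, of p x] by (simp add: LIMSEQ_const_iff)

lemma fun_calc_cong:
  assumes f: "continuous_on {0..M} f" and "\<And>r. r \<in> {0..M} \<Longrightarrow> f r = g r"
  shows "cont_fun_calc f A x = cont_fun_calc g A x"
proof -
  obtain p where p: "uniform_limit {0..M} (\<lambda>n. poly (p n)) f sequentially"
    using Weierstrass_poly_uniform_limit[OF f] by blast
  then have "uniform_limit {0..M} (\<lambda>n. poly (p n)) g sequentially"
    using assms(2) uniform_limit_cong'[of "{0..M}" "\<lambda>n. poly (p n)" "\<lambda>n. poly (p n)" f g] by simp
  from fun_calc_tendsto[OF p] fun_calc_tendsto[OF this] show ?thesis by (rule LIMSEQ_unique)
qed

lemma selfadjoint_fun_calc:
  assumes f: "continuous_on {0..M} f"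
  shows "selfadjoint (cont_fun_calc f A)"
proof -
  note sa = positive_uptoD[OF A]
  obtain p where p: "uniform_limit {0..M} (\<lambda>n. poly (p n)) f sequentially"
    using Weierstrass_poly_uniform_limit[OF f] by blast
  have "bounded_clinear (cont_fun_calc f A)"
    using cont_fun_calc_limit(1)[OF sa] uniform_limit_on_subset[OF p real_spectrum_positive_upto[OF A]]
    by blast
  moreover have "inner (cont_fun_calc f A x) y = inner x (cont_fun_calc f A y)" for x y
  proof (rule LIMSEQ_unique)
    show "(\<lambda>n. inner (poly_op (p n) A x) y) \<longlonglongrightarrow> inner (cont_fun_calc f A x) y"
      by (intro tendsto_intros fun_calc_tendsto p)
    show "(\<lambda>n. inner (poly_op (p n) A x) y) \<longlonglongrightarrow> inner x (cont_fun_calc f A y)"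
      unfolding selfadjointD(4)[OF selfadjoint_poly_op[OF sa]]
      by (intro tendsto_intros fun_calc_tendsto p)
  qed
  ultimately show ?thesis by (simp add: selfadjoint_def)
qed

lemma fun_calc_diff:
  assumes f: "continuous_on {0..M} f" and g: "continuous_on {0..M} g"
  shows "cont_fun_calc (\<lambda>r. f r - g r) A x = cont_fun_calc f A x - cont_fun_calc g A x"
proof -
  obtain p where p: "uniform_limit {0..M} (\<lambda>n. poly (p n)) f sequentially"
    using Weierstrass_poly_uniform_limit[OF f] by blast
  obtain q where q: "uniform_limit {0..M} (\<lambda>n. poly (q n)) g sequentially"
    using Weierstrass_poly_uniform_limit[OF g] by blast
  have "(\<lambda>n. poly_op (p n - q n) A x) \<longlonglongrightarrow> cont_fun_calc (\<lambda>r. f r - g r) A x"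
    using uniform_limit_minus[OF p q] by (intro fun_calc_tendsto) (simp add: poly_diff[abs_def])
  moreover have "(\<lambda>n. poly_op (p n - q n) A x) \<longlonglongrightarrow> cont_fun_calc f A x - cont_fun_calc g A x"
    unfolding poly_op_diff by (intro tendsto_intros fun_calc_tendsto p q)
  ultimately show ?thesis by (rule LIMSEQ_unique)
qed

text \<open>The product is identified weakly. Moving one factor to the other side of the inner
  product turns the limit of a composition into a limit of inner products, for which pointwise
  convergence is enough.\<close>

lemma fun_calc_mult:
  assumes f: "continuous_on {0..M} f" and g: "continuous_on {0..M} g"
  shows "cont_fun_calc (\<lambda>r. f r * g r) A x = cont_fun_calc f A (cont_fun_calc g A x)"
proof -
  note sa = positive_uptoD[OF A]
  obtain p where p: "uniform_limit {0..M} (\<lambda>n. poly (p n)) f sequentially"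
    using Weierstrass_poly_uniform_limit[OF f] by blast
  obtain q where q: "uniform_limit {0..M} (\<lambda>n. poly (q n)) g sequentially"
    using Weierstrass_poly_uniform_limit[OF g] by blast
  \<comment> \<open>Uniform limits may be multiplied when the limit functions are bounded, which
    compactness of the interval supplies.\<close>
  have bd: "bounded (h ` {0..M})" if "continuous_on {0..M} h" for h :: "real \<Rightarrow> real"
    using that by (intro compact_imp_bounded compact_continuous_image) auto
  have "uniform_limit {0..M} (\<lambda>n. poly (p n * q n)) (\<lambda>r. f r * g r) sequentially"
    using uniform_lim_mult[OF p q bd[OF f] bd[OF g]] by (simp add: poly_mult[abs_def])
  note pq = fun_calc_tendsto[OF this]
  have swap: "inner (poly_op (p n * q n) A x) y = inner (poly_op (q n) A x) (poly_op (p n) A y)" for n y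
    unfolding poly_op_mult[OF selfadjointD(2)[OF sa]]
    by (rule selfadjointD(4)[OF selfadjoint_poly_op[OF sa]])
  have "inner (cont_fun_calc (\<lambda>r. f r * g r) A x) y
      = inner (cont_fun_calc f A (cont_fun_calc g A x)) y" for y
  proof (rule LIMSEQ_unique)
    show "(\<lambda>n. inner (poly_op (p n * q n) A x) y)
        \<longlonglongrightarrow> inner (cont_fun_calc (\<lambda>r. f r * g r) A x) y"
      by (intro tendsto_intros pq)
    show "(\<lambda>n. inner (poly_op (p n * q n) A x) y)
        \<longlonglongrightarrow> inner (cont_fun_calc f A (cont_fun_calc g A x)) y"
      unfolding swap selfadjointD(4)[OF selfadjoint_fun_calc[OF f]]
      by (intro tendsto_intros fun_calc_tendsto p q)
  qed
  then show ?thesis using vector_eq_rdot by blast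
qed

lemma fun_calc_norm:
  assumes f: "continuous_on {0..M} f"
  shows "(norm (cont_fun_calc f A x))\<^sup>2 = inner (cont_fun_calc (\<lambda>r. (f r)\<^sup>2) A x) x"
  using selfadjointD(4)[OF selfadjoint_fun_calc[OF f], of "cont_fun_calc f A x" x]
  unfolding power2_norm_eq_inner unfolding power2_eq_square fun_calc_mult[OF f f] by (rule sym)

text \<open>On the interval g - f is the square of the continuous function sqrt(g - f), so its
  quadratic form is a squared norm.\<close>

lemma fun_calc_mono:
  assumes f: "continuous_on {0..M} f" and g: "continuous_on {0..M} g"
    and le: "\<And>r. r \<in> {0..M} \<Longrightarrow> f r \<le> g r"
  shows "inner (cont_fun_calc f A x) x \<le> inner (cont_fun_calc g A x) x"
proof -
  let ?d = "\<lambda>r. g r - f r" and ?s = "\<lambda>r. sqrt (g r - f r)"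
  have d: "continuous_on {0..M} ?d" and s: "continuous_on {0..M} ?s"
    by (intro continuous_intros f g)+
  have "cont_fun_calc ?d A x = cont_fun_calc (\<lambda>r. (?s r)\<^sup>2) A x"
    using le by (intro fun_calc_cong d) auto
  then have "inner (cont_fun_calc ?d A x) x = (norm (cont_fun_calc ?s A x))\<^sup>2"
    by (simp add: fun_calc_norm[OF s])
  then have "0 \<le> inner (cont_fun_calc ?d A x) x" by simp
  then show ?thesis by (simp add: fun_calc_diff[OF g f] inner_diff_left)
qed

end

text \<open>A polynomial sequence approximating f on \<open>{0..M}\<close> computes f at both
  operators, and the identity for polynomials passes to the limit because T is continuous.\<close>

lemma fun_calc_intertwine:
  fixes A A' :: "'a::complex_hilbert_space \<Rightarrow> 'a"
  assumes A: "positive_upto M A" and A': "positive_upto M A'" and f: "continuous_on {0..M} f"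
    and T: "bounded_linear T" and comm: "\<And>x. T (A x) = A' (T x)"
  shows "T (cont_fun_calc f A x) = cont_fun_calc f A' (T x)"
proof -
  obtain p where p: "uniform_limit {0..M} (\<lambda>n. poly (p n)) f sequentially"
    using Weierstrass_poly_uniform_limit[OF f] by blast
  have "(\<lambda>n. T (poly_op (p n) A x)) \<longlonglongrightarrow> T (cont_fun_calc f A x)"
    by (intro bounded_linear.tendsto[OF T] fun_calc_tendsto[OF A p])
  moreover have "T (poly_op (p n) A x) = poly_op (p n) A' (T x)" for n
    using comm by (intro poly_op_intertwine selfadjointD(3) positive_uptoD[OF A]
        positive_uptoD[OF A'] bounded_linear.linear[OF T])
  ultimately show ?thesis using fun_calc_tendsto[OF A' p, of "T x"] by (auto intro: LIMSEQ_unique)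
qed

subsection \<open>Adjoints and real powers\<close>

lemma Re_Im_cinner:
  shows "Re (cinner x y) = inner x y" and "Im (cinner x y) = inner x (\<i> *\<^sub>C y)"
  by (simp_all add: inner_eq_Re_cinner cinner_scaleC_right)

lemma ex_unimodular:
  obtains c where "cmod c = 1" "c * z = complex_of_real (cmod z)"
proof (cases "z = 0")
  case True
  then show ?thesis using that[of 1] by simp
next
  case False
  show ?thesis
  proof (rule that)
    show "cmod (cnj z / cmod z) = 1" using False by (simp add: norm_divide)
    show "cnj z / cmod z * z = complex_of_real (cmod z)"
      using False complex_norm_square[of z] by (simp add: field_simps power2_eq_square)
  qed
qed

lemma norm_cinner_le: "cmod (cinner x y) \<le> norm x * norm y"
proof -
  obtain c where c: "cmod c = 1" "c * cinner x y = complex_of_real (cmod (cinner x y))"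
    by (rule ex_unimodular)
  have "cmod (cinner x y) = inner (c *\<^sub>C x) y"
    unfolding inner_eq_Re_cinner cinner_scaleC_left c(2) by simp
  also have "\<dots> \<le> norm (c *\<^sub>C x) * norm y" by (rule norm_cauchy_schwarz)
  finally show ?thesis by (simp add: norm_scaleC c(1))
qed

text \<open>Riesz for the real functionals Re <Tx,y> produces a candidate that satisfies the real
  identity. The imaginary part follows from Im <u,v> = -Re <iu,v>, since T commutes with i.\<close>

lemma cadjoint_cinner:
  fixes T :: "'a::complex_hilbert_space \<Rightarrow> 'a"
  assumes T: "bounded_clinear T"
  shows "cinner (T x) y = cinner x (cadjoint T y)"
proof -
  have "\<exists>z. \<forall>x. inner (T x) y = inner x z" for y
    using Riesz_representation[OF bounded_linear_inner_left_comp[OF bounded_clinear_imp_bounded_linear[OF T]]]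
    by metis
  then obtain S where S: "\<And>x y. inner (T x) y = inner x (S y)" by metis
  have Sadj: "cinner (T x) y = cinner x (S y)" for x y
  proof -
    have "Im (cinner u v) = - inner (\<i> *\<^sub>C u) v" for u v :: 'a
      by (simp add: inner_eq_Re_cinner cinner_scaleC_left)
    then show ?thesis
      by (simp add: complex_eq_iff Re_Im_cinner(1) S flip: bounded_clinear_scaleC[OF T])
  qed
  have "S' = S" if "\<forall>x y. cinner (T x) y = cinner x (S' y)" for S'
  proof
    fix y
    have "inner x (S' y) = inner x (S y)" for x
      using that Sadj by (simp add: inner_eq_Re_cinner)
    then show "S' y = S y" using vector_eq_ldot by blast
  qed
  then have "cadjoint T = S" unfolding cadjoint_def using Sadj by (intro the_equality) auto
  then show ?thesis using Sadj by simp
qed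

lemma cadjoint_inner:
  fixes T :: "'a::complex_hilbert_space \<Rightarrow> 'a"
  shows "bounded_clinear T \<Longrightarrow> inner (T x) y = inner x (cadjoint T y)"
  by (simp add: inner_eq_Re_cinner cadjoint_cinner)

lemma bounded_clinear_cadjoint:
  fixes T :: "'a::complex_hilbert_space \<Rightarrow> 'a"
  assumes T: "bounded_clinear T"
  shows "bounded_clinear (cadjoint T)"
proof -
  let ?S = "cadjoint T"
  note adj = cadjoint_inner[OF T] and bl = bounded_clinear_imp_bounded_linear[OF T]
  have eqI: "u = v" if "\<And>x. inner x u = inner x v" for u v :: 'a
    using that vector_eq_ldot by blast
  have add: "?S (x + y) = ?S x + ?S y" for x y
    by (rule eqI) (simp add: inner_add_right flip: adj)
  have sc: "?S (c *\<^sub>C x) = c *\<^sub>C ?S x" for c x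
    by (rule eqI) (simp add: inner_eq_Re_cinner cinner_scaleC_right flip: cadjoint_cinner[OF T])
  have "norm (?S y) \<le> norm y * onorm T" for y
  proof (cases "?S y = 0")
    case False
    have "norm (?S y) * norm (?S y) = inner (T (?S y)) y"
      by (simp add: adj dot_square_norm power2_eq_square)
    also have "\<dots> \<le> norm (T (?S y)) * norm y" by (rule norm_cauchy_schwarz)
    also have "\<dots> \<le> onorm T * norm (?S y) * norm y" by (intro mult_right_mono onorm[OF bl]) simp
    finally have "norm (?S y) * norm (?S y) \<le> (norm y * onorm T) * norm (?S y)"
      by (simp only: mult_ac)
    then show ?thesis using False by simp
  qed (simp add: onorm_pos_le[OF bl])
  then have "bounded_linear ?S"
    by (intro bounded_linear_intro[where K = "onorm T"]) (auto simp: add sc scaleR_eq_scaleC)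
  then show ?thesis using sc by (simp add: bounded_clinear_def)
qed

lemma cadjoint_cadjoint:
  fixes T :: "'a::complex_hilbert_space \<Rightarrow> 'a"
  assumes T: "bounded_clinear T"
  shows "cadjoint (cadjoint T) = T"
proof
  fix y
  have "inner x (cadjoint (cadjoint T) y) = inner x (T y)" for x
    using cadjoint_inner[OF bounded_clinear_cadjoint[OF T], of x y] cadjoint_inner[OF T, of y x]
    by (simp add: inner_commute)
  then show "cadjoint (cadjoint T) y = T y" using vector_eq_ldot by blast
qed

lemma selfadjoint_cinner:
  assumes "selfadjoint A"
  shows "cinner (A x) y = cinner x (A y)"
  using selfadjointD[OF assms]
  by (simp add: complex_eq_iff Re_Im_cinner bounded_clinear_scaleC)

lemma positive_cadjoint_comp:
  fixes T :: "'a::complex_hilbert_space \<Rightarrow> 'a"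
  assumes T: "bounded_clinear T" and "onorm (cadjoint T \<circ> T) \<le> M"
  shows "positive_upto M (cadjoint T \<circ> T)"
proof -
  have adj: "inner (cadjoint T (T x)) y = inner (T x) (T y)" for x y
    using cadjoint_inner[OF T, of y "T x"] by (simp add: inner_commute)
  have "bounded_clinear (cadjoint T \<circ> T)"
    using T bounded_clinear_cadjoint[OF T] bounded_linear_compose[of "cadjoint T" T]
    by (simp add: bounded_clinear_def o_def)
  then show ?thesis using assms(2)
    by (simp add: positive_upto_def selfadjoint_def adj flip: cadjoint_inner[OF T])
qed

text \<open>\<open>op_powr\<close> treats the exponent \<open>0\<close> separately; with this convention the functional calculus
  and the law of exponents hold uniformly for \<open>s \<ge> 0\<close>.\<close>

definition power0 :: "real \<Rightarrow> real \<Rightarrow> real"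
  where "power0 s r = (if s = 0 then 1 else r powr s)"

lemma continuous_on_power0: "0 \<le> s \<Longrightarrow> continuous_on {0..M} (power0 s)"
  by (cases "s = 0")
    (auto simp: power0_def[abs_def] intro: continuous_on_powr'[OF continuous_on_id continuous_on_const])

text \<open>For nonnegative exponents a + b = 0 forces a = b = 0, so the value 1 of
  \<open>power0 0\<close> at r = 0 never clashes with the value 0 of the other powers there.\<close>

lemma power0_add: "0 \<le> a \<Longrightarrow> 0 \<le> b \<Longrightarrow> power0 a r * power0 b r = power0 (a + b) r"
  by (simp add: power0_def powr_add add_nonneg_eq_0_iff)

lemma power0_square: "0 \<le> s \<Longrightarrow> (power0 s r)\<^sup>2 = power0 (2 * s) r"
  using power0_add[of s s r] by (simp add: power2_eq_square)

lemma power0_one: "0 \<le> r \<Longrightarrow> power0 1 r = r"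
  by (simp add: power0_def)

lemma fun_calc_const:
  fixes A :: "'a::complex_hilbert_space \<Rightarrow> 'a"
  shows "positive_upto M A \<Longrightarrow> cont_fun_calc (\<lambda>_. c) A x = c *\<^sub>R x"
  using fun_calc_poly[of M A "[:c:]" x]
  by (simp add: poly_op_const selfadjointD(3)[OF positive_uptoD] poly_pCons[abs_def])

lemma fun_calc_ident:
  fixes A :: "'a::complex_hilbert_space \<Rightarrow> 'a"
  shows "positive_upto M A \<Longrightarrow> cont_fun_calc (\<lambda>r. r) A x = A x"
  using fun_calc_poly[of M A "[:0, 1:]" x]
  by (simp add: poly_op_pCons selfadjointD(3)[OF positive_uptoD] linear_0 poly_pCons[abs_def])

lemma op_powr_eq_fun_calc:
  fixes A :: "'a::complex_hilbert_space \<Rightarrow> 'a"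
  assumes "positive_upto M A"
  shows "op_powr A s x = cont_fun_calc (power0 s) A x"
  using fun_calc_const[OF assms, of 1 x] by (auto simp: op_powr_def power0_def[abs_def])

text \<open>Converts the norms in the mixed Schwarz inequality into quadratic forms with doubled
  exponents, the summands of Q; it also shows that powers are positive.\<close>

lemma norm_op_powr:
  fixes A :: "'a::complex_hilbert_space \<Rightarrow> 'a"
  assumes A: "positive_upto M A" and s: "0 \<le> s"
  shows "(norm (op_powr A s x))\<^sup>2 = inner (op_powr A (2 * s) x) x"
  unfolding op_powr_eq_fun_calc[OF A] fun_calc_norm[OF A continuous_on_power0[OF s]]
    power0_square[OF s] ..

lemma selfadjoint_op_powr:
  fixes A :: "'a::complex_hilbert_space \<Rightarrow> 'a"
  assumes A: "positive_upto M A" and s: "0 \<le> s"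
  shows "selfadjoint (op_powr A s)"
proof -
  have "op_powr A s = cont_fun_calc (power0 s) A"
    by (rule ext) (rule op_powr_eq_fun_calc[OF A])
  then show ?thesis using selfadjoint_fun_calc[OF A continuous_on_power0[OF s]] by simp
qed

lemma positive_op_powr:
  fixes A :: "'a::complex_hilbert_space \<Rightarrow> 'a"
  assumes A: "positive_upto M A" and s: "0 \<le> s" and "onorm (op_powr A s) \<le> N"
  shows "positive_upto N (op_powr A s)"
proof -
  have "0 \<le> inner (op_powr A s x) x" for x
    using norm_op_powr[OF A, of "s / 2" x] s zero_le_power2[of "norm (op_powr A (s / 2) x)"] by simp
  then show ?thesis using selfadjoint_op_powr[OF A s] assms(3) by (simp add: positive_upto_def)
qed

lemma op_abs_square:
  fixes T :: "'a::complex_hilbert_space \<Rightarrow> 'a"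
  assumes T: "bounded_clinear T"
  shows "op_abs T (op_abs T x) = cadjoint T (T x)"
proof -
  let ?A = "cadjoint T \<circ> T"
  have A: "positive_upto (onorm ?A) ?A" by (intro positive_cadjoint_comp T order_refl)
  have c: "continuous_on {0..onorm ?A} (power0 (1 / 2))" by (rule continuous_on_power0) simp
  have "op_abs T (op_abs T x) = cont_fun_calc (\<lambda>r. power0 (1 / 2) r * power0 (1 / 2) r) ?A x"
    unfolding op_abs_def op_powr_eq_fun_calc[OF A] fun_calc_mult[OF A c c] ..
  also have "\<dots> = cont_fun_calc (\<lambda>r. r) ?A x"
    by (intro fun_calc_cong[OF A]) (auto simp: power0_add power0_one continuous_on_power0)
  finally show ?thesis by (simp add: fun_calc_ident[OF A])
qed

lemma positive_op_abs:
  fixes T :: "'a::complex_hilbert_space \<Rightarrow> 'a"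
  assumes T: "bounded_clinear T" and "onorm (op_abs T) \<le> M"
  shows "positive_upto M (op_abs T)"
  unfolding op_abs_def
  by (rule positive_op_powr[OF positive_cadjoint_comp[OF T order_refl]])
    (use assms(2) in \<open>simp_all add: op_abs_def\<close>)

text \<open>With T' the adjoint, T(T'T) = (TT')T holds by associativity and passes to square roots;
  M is chosen to bound both products.\<close>

lemma op_abs_intertwine:
  fixes T :: "'a::complex_hilbert_space \<Rightarrow> 'a"
  assumes T: "bounded_clinear T"
  shows "T (op_abs T x) = op_abs (cadjoint T) (T x)"
proof -
  let ?T' = "cadjoint T"
  define M where "M = max (onorm (?T' \<circ> T)) (onorm (T \<circ> ?T'))"
  have A: "positive_upto M (?T' \<circ> T)" by (rule positive_cadjoint_comp[OF T]) (simp add: M_def)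
  have A': "positive_upto M (T \<circ> ?T')"
    using positive_cadjoint_comp[OF bounded_clinear_cadjoint[OF T], of M]
    by (simp add: cadjoint_cadjoint[OF T] M_def)
  show ?thesis
    unfolding op_abs_def cadjoint_cadjoint[OF T] op_powr_eq_fun_calc[OF A] op_powr_eq_fun_calc[OF A']
    by (rule fun_calc_intertwine[OF A A' _ bounded_clinear_imp_bounded_linear[OF T]])
      (simp_all add: continuous_on_power0)
qed

subsection \<open>The mixed Schwarz inequality\<close>

text \<open>Without a polar decomposition: \<open>T = T(|T| + e)\<^sup>-\<^sup>1 |T|\<^sup>b |T|\<^sup>a\<close> up to an error of norm at most
  \<open>e\<close>, and \<open>T g(|T|) = g(|T\<^sup>*|) T\<close> moves the middle factors to the other side of \<open>T\<close>.\<close>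

lemma mixed_Schwarz_approx:
  fixes T :: "'a::complex_hilbert_space \<Rightarrow> 'a"
  assumes T: "bounded_clinear T" and ab: "0 \<le> a" "0 \<le> b" "a + b = 1" and e: "0 < e"
  shows "cmod (cinner (T x) x)
    \<le> norm (op_powr (op_abs T) a x) * norm (op_powr (op_abs (cadjoint T)) b x) + e * (norm x)\<^sup>2"
proof -
  let ?T' = "cadjoint T" and ?P = "op_abs T" and ?R = "op_abs (cadjoint T)"
  note T' = bounded_clinear_cadjoint[OF T]
  note bl = bounded_clinear_imp_bounded_linear[OF T]
  interpret T: bounded_linear T by (rule bl)
  define M where "M = max (onorm ?P) (onorm ?R)"
  have P: "positive_upto M ?P" by (rule positive_op_abs[OF T]) (simp add: M_def)
  have R: "positive_upto M ?R" by (rule positive_op_abs[OF T']) (simp add: M_def)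
  \<comment> \<open>A regularised inverse of |T|, which itself need not be invertible; e > 0 makes
    it continuous up to 0. In \<open>g\<close> it is combined with r^b, so that g(r) r^a = h(r) r, a
    function close to 1 away from r = 0.\<close>
  define h where "h r = 1 / (r + e)" for r
  define g where "g r = h r * power0 b r" for r
  have h: "continuous_on {0..M} h" unfolding h_def using e by (intro continuous_intros) auto
  have pa: "continuous_on {0..M} (power0 a)" and pb: "continuous_on {0..M} (power0 b)"
    by (intro continuous_on_power0 ab)+
  have g: "continuous_on {0..M} g" unfolding g_def by (intro continuous_intros h pb)
  have hr: "continuous_on {0..M} (\<lambda>r. h r * r)" by (intro continuous_intros h)
  have h1: "continuous_on {0..M} (\<lambda>r. 1 - h r * r)" by (intro continuous_intros h)
  define w where "w = op_powr ?P a x"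
  define y where "y = x - cont_fun_calc (\<lambda>r. h r * r) ?P x"
  have "cont_fun_calc (\<lambda>r. h r * r) ?P x = cont_fun_calc (\<lambda>r. g r * power0 a r) ?P x"
  proof (rule fun_calc_cong[OF P hr])
    fix r assume "r \<in> {0..M}"
    then have "power0 b r * power0 a r = r" using ab power0_add[of b a r] power0_one[of r]
      by (simp add: add.commute)
    then show "h r * r = g r * power0 a r" by (simp add: g_def mult.assoc)
  qed
  then have "x = y + cont_fun_calc g ?P w"
    by (simp add: y_def w_def op_powr_eq_fun_calc[OF P] fun_calc_mult[OF P g pa])
  then have "T x = T y + T (cont_fun_calc g ?P w)" by (metis T.add)
  then have split: "cinner (T x) x = cinner (T y) x + cinner (T (cont_fun_calc g ?P w)) x"
    by (simp add: cinner_add_left)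

  have "y = cont_fun_calc (\<lambda>r. 1 - h r * r) ?P x"
    unfolding y_def using fun_calc_diff[OF P continuous_on_const hr, of 1 x]
    by (simp add: fun_calc_const[OF P])
  then have Py: "?P y = cont_fun_calc (\<lambda>r. r * (1 - h r * r)) ?P x"
    by (simp add: fun_calc_mult[OF P continuous_on_id h1] fun_calc_ident[OF P])
  \<comment> \<open>T and |T| have equal norms at every vector. Since |T| y comes from the function
    r (1 - h(r) r) = e r / (r + e), which lies between 0 and e, the remainder is small even though y
    itself need not be.\<close>
  have "(norm (T y))\<^sup>2 = (norm (?P y))\<^sup>2"
    using selfadjointD(4)[OF positive_uptoD[OF P], of "?P y" y] cadjoint_inner[OF T, of y "T y"]
    by (simp add: power2_norm_eq_inner op_abs_square[OF T] inner_commute)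
  also have "\<dots> = inner (cont_fun_calc (\<lambda>r. (r * (1 - h r * r))\<^sup>2) ?P x) x"
    unfolding Py by (rule fun_calc_norm[OF P]) (intro continuous_intros h)
  also have "\<dots> \<le> inner (cont_fun_calc (\<lambda>_. e\<^sup>2) ?P x) x"
  proof (rule fun_calc_mono[OF P])
    fix r assume r: "r \<in> {0..M}"
    then have "r * (1 - h r * r) = e * (r / (r + e))" using e
      by (simp add: h_def field_simps)
    moreover have "0 \<le> e * (r / (r + e))" using r e by simp
    moreover have "e * (r / (r + e)) \<le> e" using r e by (intro mult_left_le) auto
    ultimately show "(r * (1 - h r * r))\<^sup>2 \<le> e\<^sup>2" by (metis power_mono)
  qed (intro continuous_intros h)+
  also have "\<dots> = (e * norm x)\<^sup>2"
    by (simp add: fun_calc_const[OF P] power_mult_distrib power2_norm_eq_inner)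
  finally have "norm (T y) \<le> e * norm x" by (rule power2_le_imp_le) (use e in simp)
  then have err: "cmod (cinner (T y) x) \<le> e * (norm x)\<^sup>2"
    using order_trans[OF norm_cinner_le mult_right_mono[of "norm (T y)" "e * norm x" "norm x"]]
    by (simp add: power2_eq_square mult.assoc)

  have g2: "continuous_on {0..M} (\<lambda>r. (g r)\<^sup>2)" by (intro continuous_intros g)
  have g2r: "continuous_on {0..M} (\<lambda>r. (g r)\<^sup>2 * r)" by (intro continuous_intros g)
  \<comment> \<open>Carrying g^2 through T replaces |T| by the modulus of the adjoint, and TT' is
    the square of that modulus. The resulting function is (h(r) r)^2 r^(2b), and h(r) r \<le> 1
    removes the regularisation.\<close>
  have "(norm (cont_fun_calc g ?P (?T' x)))\<^sup>2
      = inner (cont_fun_calc (\<lambda>r. (g r)\<^sup>2) ?P (?T' x)) (?T' x)"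
    by (rule fun_calc_norm[OF P g])
  also have "\<dots> = inner (T (cont_fun_calc (\<lambda>r. (g r)\<^sup>2) ?P (?T' x))) x"
    by (simp add: cadjoint_inner[OF T])
  also have "\<dots> = inner (cont_fun_calc (\<lambda>r. (g r)\<^sup>2) ?R (T (?T' x))) x"
    by (simp add: fun_calc_intertwine[OF P R g2 bl op_abs_intertwine[OF T]])
  also have "T (?T' x) = ?R (?R x)"
    using op_abs_square[OF T', of x] by (simp add: cadjoint_cadjoint[OF T])
  also have "cont_fun_calc (\<lambda>r. (g r)\<^sup>2) ?R (?R (?R x)) = cont_fun_calc (\<lambda>r. (g r)\<^sup>2 * r * r) ?R x"
    by (simp add: fun_calc_mult[OF R g2r continuous_on_id] fun_calc_mult[OF R g2 continuous_on_id]
        fun_calc_ident[OF R])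
  also have "inner \<dots> x \<le> inner (cont_fun_calc (\<lambda>r. (power0 b r)\<^sup>2) ?R x) x"
  proof (rule fun_calc_mono[OF R])
    fix r assume r: "r \<in> {0..M}"
    have "0 \<le> h r * r" "h r * r \<le> 1" using r e by (auto simp: h_def)
    then have "(h r * r)\<^sup>2 \<le> 1" by (simp add: power_le_one)
    then have "(power0 b r)\<^sup>2 * (h r * r)\<^sup>2 \<le> (power0 b r)\<^sup>2" by (intro mult_left_le) auto
    then show "(g r)\<^sup>2 * r * r \<le> (power0 b r)\<^sup>2"
      by (simp add: g_def power2_eq_square mult_ac)
  qed (intro continuous_intros g pb)+
  also have "\<dots> = (norm (op_powr ?R b x))\<^sup>2"
    by (simp add: op_powr_eq_fun_calc[OF R] fun_calc_norm[OF R pb])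
  finally have main: "norm (cont_fun_calc g ?P (?T' x)) \<le> norm (op_powr ?R b x)"
    by (rule power2_le_imp_le) simp
  have "cinner (T (cont_fun_calc g ?P w)) x = cinner w (cont_fun_calc g ?P (?T' x))"
    by (simp add: cadjoint_cinner[OF T] selfadjoint_cinner[OF selfadjoint_fun_calc[OF P g]])
  then have "cmod (cinner (T (cont_fun_calc g ?P w)) x) \<le> norm w * norm (op_powr ?R b x)"
    using order_trans[OF norm_cinner_le mult_left_mono[OF main, of "norm w"]] by simp
  then show ?thesis unfolding split w_def
    using err norm_triangle_ineq[of "cinner (T y) x" "cinner (T (cont_fun_calc g ?P w)) x"]
    by (simp add: w_def)
qed

lemma mixed_Schwarz:
  fixes T :: "'a::complex_hilbert_space \<Rightarrow> 'a"
  assumes T: "bounded_clinear T" and ab: "0 \<le> a" "0 \<le> b" "a + b = 1"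
  shows "cmod (cinner (T x) x) \<le> norm (op_powr (op_abs T) a x) * norm (op_powr (op_abs (cadjoint T)) b x)"
proof (rule field_le_epsilon)
  fix e :: real assume e: "0 < e"
  have "e / ((norm x)\<^sup>2 + 1) * (norm x)\<^sup>2 \<le> e"
    using e by (simp add: pos_divide_le_eq add_nonneg_pos)
  then show "cmod (cinner (T x) x)
      \<le> norm (op_powr (op_abs T) a x) * norm (op_powr (op_abs (cadjoint T)) b x) + e"
    using mixed_Schwarz_approx[OF T ab, of "e / ((norm x)\<^sup>2 + 1)" x] e
    by (simp add: add_nonneg_pos)
qed

subsection \<open>The numerical radius\<close>

lemma numerical_radius_upper:
  fixes T :: "'a::complex_inner \<Rightarrow> 'a"
  assumes T: "bounded_clinear T"
  shows "cmod (cinner (T x) x) \<le> numerical_radius T * (norm x)\<^sup>2"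
proof (cases "x = 0")
  case True
  then show ?thesis using norm_cinner_le[of "T x" x] by simp
next
  case False
  note bl = bounded_clinear_imp_bounded_linear[OF T]
  define u where "u = (1 / norm x) *\<^sub>R x"
  have u: "norm u = 1" "x = norm x *\<^sub>R u" using False by (simp_all add: u_def)
  have "bdd_above (insert 0 {cmod (cinner (T x) x) | x. norm x = 1})"
  proof (rule bdd_aboveI[of _ "onorm T"])
    fix s assume "s \<in> insert 0 {cmod (cinner (T x) x) | x. norm x = 1}"
    then consider "s = 0" | v where "s = cmod (cinner (T v) v)" "norm v = 1" by blast
    then show "s \<le> onorm T"
    proof cases
      case 1
      then show ?thesis using onorm_pos_le[OF bl] by simp
    next
      case 2
      then show ?thesis using norm_cinner_le[of "T v" v] onorm[OF bl, of v] by simp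
    qed
  qed
  then have "cmod (cinner (T u) u) \<le> numerical_radius T"
    unfolding numerical_radius_def using u(1) by (intro cSup_upper) auto
  moreover have "cmod (cinner (T x) x) = (norm x)\<^sup>2 * cmod (cinner (T u) u)"
  proof -
    have "cinner (T x) x = complex_of_real ((norm x)\<^sup>2) * cinner (T u) u"
      by (subst (1 2) u(2)) (simp add: scaleR_eq_scaleC bounded_clinear_scaleC[OF T]
          cinner_scaleC_left cinner_scaleC_right power2_eq_square)
    then show ?thesis by (simp add: norm_mult norm_power)
  qed
  ultimately show ?thesis by (simp add: mult.commute[of "(norm x)\<^sup>2"] mult_right_mono)
qed

lemma numerical_radius_least:
  assumes "0 \<le> b" "\<And>x. norm x = 1 \<Longrightarrow> cmod (cinner (T x) x) \<le> b"
  shows "numerical_radius T \<le> b"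
  unfolding numerical_radius_def using assms by (intro cSup_least) auto

text \<open>Polarisation with y of the same length as x and in the direction of \<open>H x\<close>:
  4 <Hx,y> is the difference of the forms at x + y and x - y, and the parallelogram law bounds it by
  4 w |x|^2.\<close>

lemma norm_le_symmetric_form:
  fixes H :: "'a::real_inner \<Rightarrow> 'a"
  assumes "linear H" and sym: "\<And>x y. inner (H x) y = inner x (H y)"
    and w: "\<And>x. \<bar>inner (H x) x\<bar> \<le> w * (norm x)\<^sup>2"
  shows "norm (H x) \<le> w * norm x"
proof (cases "H x = 0 \<or> x = 0")
  case True
  show ?thesis
  proof (cases "x = 0")
    case False
    then have "0 \<le> w * (norm x)\<^sup>2" using w[of x] by linarith
    then show ?thesis using True False by (simp add: zero_le_mult_iff)
  qed (simp add: linear_0[OF assms(1)])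
next
  case False
  interpret H: linear H by fact
  define y where "y = (norm x / norm (H x)) *\<^sub>R H x"
  have ny: "norm y = norm x" using False by (simp add: y_def)
  have "inner (H (x + y)) (x + y) - inner (H (x - y)) (x - y) = 4 * inner (H x) y"
    using sym[of y x] by (simp add: H.add H.diff inner_add_left inner_add_right inner_diff_left
        inner_diff_right inner_commute)
  moreover have "inner (H x) y = norm x * norm (H x)"
    using False by (simp add: y_def dot_square_norm power2_eq_square)
  moreover have "w * (norm (x + y))\<^sup>2 + w * (norm (x - y))\<^sup>2 = w * (4 * (norm x)\<^sup>2)"
    unfolding distrib_left[symmetric] using power2_norm_eq_inner[of x] power2_norm_eq_inner[of y] ny
    by (simp add: power2_norm_eq_inner[of "x + y"] power2_norm_eq_inner[of "x - y"] inner_add_left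
        inner_add_right inner_diff_left inner_diff_right inner_commute)
  ultimately have "norm x * norm (H x) \<le> w * (norm x)\<^sup>2"
    using w[of "x + y"] w[of "x - y"] by linarith
  then have "norm x * norm (H x) \<le> norm x * (w * norm x)"
    by (simp add: power2_eq_square mult_ac)
  then show ?thesis using False by simp
qed

text \<open>\<open>H\<close> is the real part of \<open>c T\<close>.\<close>

lemma rotated_real_part:
  fixes T Q :: "'a::complex_hilbert_space \<Rightarrow> 'a"
  assumes T: "bounded_clinear T" and Q: "selfadjoint Q" and c: "cmod c = 1"
  obtains H where "\<And>x. norm (H x) \<le> numerical_radius T * norm x"
    "\<And>x. inner (H x) x = Re (c * cinner (T x) x)"
    "\<And>x. 2 * inner (Q x) (H x) = Re (c * cinner (T (Q x) + Q (T x)) x)"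
proof -
  let ?T' = "cadjoint T"
  note T' = bounded_clinear_cadjoint[OF T]
  have scale: "linear (\<lambda>v::'a. c *\<^sub>C v)" for c
    by (rule linearI) (simp_all add: scaleC_add_right scaleR_eq_scaleC scaleC_scaleC mult.commute)
  define H where "H x = (1/2) *\<^sub>R (c *\<^sub>C T x + cnj c *\<^sub>C ?T' x)" for x
  \<comment> \<open>The right side is symmetric in x and y, so \<open>H\<close> is symmetric.
    Setting y = x gives the quadratic form, and y = Q x gives the anticommutator identity once Q is
    moved across the inner product.\<close>
  have form: "2 * inner (H x) y = Re (c * cinner (T x) y) + Re (c * cinner (T y) x)" for x y
  proof -
    have "inner (cnj c *\<^sub>C ?T' x) y = Re (cnj c * cnj (cinner (T y) x))"
      unfolding inner_eq_Re_cinner cinner_scaleC_left cadjoint_cinner[OF T]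
      using cinner_commute[of "?T' x" y] by simp
    then have "inner (cnj c *\<^sub>C ?T' x) y = Re (c * cinner (T y) x)" by simp
    moreover have "inner (c *\<^sub>C T x) y = Re (c * cinner (T x) y)"
      by (simp add: inner_eq_Re_cinner cinner_scaleC_left)
    ultimately show ?thesis by (simp add: H_def inner_add_left)
  qed
  have self: "inner (H x) x = Re (c * cinner (T x) x)" for x using form[of x x] by simp
  have "linear H" unfolding H_def
    using T T' by (intro linear_compose_scale_right linear_compose_add
        linear_compose[OF _ scale, unfolded o_def]) (auto simp: bounded_clinear_def bounded_linear.linear)
  moreover have "inner (H x) y = inner x (H y)" for x y
    using form[of x y] form[of y x] by (simp add: inner_commute)
  moreover have "\<bar>inner (H x) x\<bar> \<le> numerical_radius T * (norm x)\<^sup>2" for x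
    unfolding self using abs_Re_le_cmod[of "c * cinner (T x) x"] numerical_radius_upper[OF T, of x] c
    by (simp add: norm_mult)
  ultimately have "norm (H x) \<le> numerical_radius T * norm x" for x
    by (rule norm_le_symmetric_form)
  moreover have "2 * inner (Q x) (H x) = Re (c * cinner (T (Q x) + Q (T x)) x)" for x
    using form[of x "Q x"]
    by (simp add: inner_commute cinner_add_left selfadjoint_cinner[OF Q] algebra_simps)
  ultimately show ?thesis using self by (intro that)
qed

text \<open>Isolates what the powers of the moduli have to deliver: a selfadjoint Q whose quadratic
  form dominates twice the modulus of that of T.\<close>

lemma numerical_radius_refinement:
  fixes T Q :: "'a::complex_hilbert_space \<Rightarrow> 'a"
  assumes T: "bounded_clinear T" and Q: "selfadjoint Q"
    and dom: "\<And>x. 2 * cmod (cinner (T x) x) \<le> inner (Q x) x"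
  defines "w \<equiv> numerical_radius T" and "W \<equiv> numerical_radius (\<lambda>x. T (Q x) + Q (T x))"
  shows "w \<le> sqrt (1 / 16 * (onorm Q)\<^sup>2 + 1 / 4 * w\<^sup>2 + 1 / 8 * W)" (is "_ \<le> sqrt ?S")
    and "sqrt (1 / 16 * (onorm Q)\<^sup>2 + 1 / 4 * w\<^sup>2 + 1 / 8 * W) \<le> 1 / 4 * onorm Q + 1 / 2 * w"
    and "w \<le> 1 / 2 * onorm Q"
proof -
  note blQ = selfadjointD(2)[OF Q] and blT = bounded_clinear_imp_bounded_linear[OF T]
  have N0: "0 \<le> onorm Q" by (rule onorm_pos_le[OF blQ])
  have Qx: "norm (Q x) \<le> onorm Q" if "norm x = 1" for x using onorm[OF blQ, of x] that by simp
  have nonneg: "0 \<le> numerical_radius S" if "bounded_clinear S" for S :: "'a \<Rightarrow> 'a"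
  proof (cases "\<exists>x::'a. x \<noteq> 0")
    case True
    then obtain x :: 'a where "x \<noteq> 0" by blast
    moreover have "0 \<le> numerical_radius S * (norm x)\<^sup>2"
      using numerical_radius_upper[OF that, of x] norm_ge_zero order_trans by blast
    ultimately show ?thesis by (simp add: zero_le_mult_iff)
  next
    \<comment> \<open>On the zero space there are no unit vectors, and the inserted 0 makes the
      supremum 0.\<close>
    case False
    then have "norm x \<noteq> 1" for x :: 'a by (metis norm_zero zero_neq_one)
    then have "{cmod (cinner (S x) x) | x. norm x = 1} = {}" by blast
    then show ?thesis by (simp add: numerical_radius_def)
  qed
  have w0: "0 \<le> w" unfolding w_def by (rule nonneg[OF T])
  show third: "w \<le> 1 / 2 * onorm Q" unfolding w_def
  proof (rule numerical_radius_least)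
    fix x :: 'a assume x: "norm x = 1"
    have "2 * cmod (cinner (T x) x) \<le> norm (Q x) * norm x"
      using dom[of x] norm_cauchy_schwarz[of "Q x" x] by linarith
    then show "cmod (cinner (T x) x) \<le> 1 / 2 * onorm Q" using Qx[OF x] x by simp
  qed (use N0 in simp)
  have cl: "bounded_clinear (\<lambda>x. T (Q x) + Q (T x))"
    using T selfadjointD(1)[OF Q] unfolding bounded_clinear_def
    by (auto intro!: bounded_linear_intros bounded_linear_compose[of T] bounded_linear_compose[of Q]
        simp: scaleC_add_right)
  have W0: "0 \<le> W" unfolding W_def by (rule nonneg[OF cl])
  have "W \<le> 2 * onorm Q * w" unfolding W_def
  proof (rule numerical_radius_least)
    fix x :: 'a assume x: "norm x = 1"
    let ?v = "cinner (T (Q x) + Q (T x)) x"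
    \<comment> \<open>Here c is adapted to the form of TQ + QT, not to that of T, so this
      \<open>H\<close> differs from the one in the first inequality; the bound on its norm holds for
      every unimodular c.\<close>
    obtain c where c: "cmod c = 1" "c * ?v = complex_of_real (cmod ?v)"
      by (rule ex_unimodular)
    obtain H where H: "\<And>x. norm (H x) \<le> w * norm x"
      "\<And>x. inner (H x) x = Re (c * cinner (T x) x)"
      "\<And>x. 2 * inner (Q x) (H x) = Re (c * cinner (T (Q x) + Q (T x)) x)"
      by (rule rotated_real_part[OF T Q c(1), folded w_def]) (rule that)
    have "cmod ?v = 2 * inner (Q x) (H x)" unfolding H(3) c(2) by simp
    also have "\<dots> \<le> 2 * (norm (Q x) * norm (H x))" using norm_cauchy_schwarz by simp
    also have "\<dots> \<le> 2 * (onorm Q * w)"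
      using Qx[OF x] H(1)[of x] x N0 by (intro mult_left_mono mult_mono) auto
    finally show "cmod ?v \<le> 2 * onorm Q * w" by simp
  qed (use N0 w0 in simp)
  then have "?S \<le> (1 / 4 * onorm Q + 1 / 2 * w)\<^sup>2"
    by (simp add: power2_eq_square algebra_simps)
  then show "sqrt ?S \<le> 1 / 4 * onorm Q + 1 / 2 * w"
    using N0 w0 by (intro real_le_lsqrt) auto
  have S0: "0 \<le> ?S" using W0 by simp
  show "w \<le> sqrt ?S" unfolding w_def
  proof (rule numerical_radius_least)
    fix x :: 'a assume x: "norm x = 1"
    let ?z = "cinner (T x) x"
    obtain c where c: "cmod c = 1" "c * ?z = complex_of_real (cmod ?z)"
      by (rule ex_unimodular)
    obtain H where H: "\<And>x. norm (H x) \<le> w * norm x" "\<And>x. inner (H x) x = Re (c * cinner (T x) x)"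
      "\<And>x. 2 * inner (Q x) (H x) = Re (c * cinner (T (Q x) + Q (T x)) x)"
      by (rule rotated_real_part[OF T Q c(1), folded w_def]) (rule that)
    \<comment> \<open>Half of |<Tx,x>| is at most <Qx,x>/4 by \<open>dom\<close>, the other half
      equals <Hx,x>/2. Squaring produces the weights 1/16 and 1/4, and the cross term <Qx,Hx>/4 is
      1/8 of 2 <Qx,Hx>.\<close>
    define u where "u = (1/4) *\<^sub>R Q x + (1/2) *\<^sub>R H x"
    have "cmod ?z \<le> inner u x"
      using dom[of x] by (simp add: u_def inner_add_left H(2) c(2))
    also have "\<dots> \<le> norm u" using norm_cauchy_schwarz[of u x] x by simp
    finally have zu: "cmod ?z \<le> norm u" .
    have "(norm u)\<^sup>2 = 1/16 * (norm (Q x))\<^sup>2 + 1/4 * (norm (H x))\<^sup>2 + 1/8 * (2 * inner (Q x) (H x))"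
      unfolding u_def power2_norm_eq_inner
      by (simp add: inner_add_left inner_add_right inner_commute algebra_simps)
    also have "\<dots> \<le> ?S"
    proof -
      have "2 * inner (Q x) (H x) \<le> W"
        unfolding H(3) W_def using complex_Re_le_cmod[of "c * cinner (T (Q x) + Q (T x)) x"]
          numerical_radius_upper[OF cl, of x] c(1) x by (simp add: norm_mult)
      moreover have "(norm (Q x))\<^sup>2 \<le> (onorm Q)\<^sup>2" using Qx[OF x] by (intro power_mono) auto
      moreover have "(norm (H x))\<^sup>2 \<le> w\<^sup>2" using H(1)[of x] x by (intro power_mono) auto
      ultimately show ?thesis by linarith
    qed
    finally have "norm u \<le> sqrt ?S" by (rule real_le_rsqrt)
    then show "cmod ?z \<le> sqrt (1 / 16 * (onorm Q)\<^sup>2 + 1 / 4 * (numerical_radius T)\<^sup>2 + 1 / 8 * W)"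
      using zu unfolding w_def by simp
  qed (use S0 in \<open>simp add: w_def\<close>)
qed

theorem corollary3p6:
  fixes T Q :: "'a::complex_hilbert_space \<Rightarrow> 'a" and t :: real
  assumes "bounded_clinear T"
    and "0 \<le> t" and "t \<le> 1"
    and "Q = (\<lambda>x. op_powr (op_abs (cadjoint T)) (2 * (1 - t)) x + op_powr (op_abs T) (2 * t) x)"
  shows "numerical_radius T
        \<le> sqrt (1 / 16 * (onorm Q)\<^sup>2 + 1 / 4 * (numerical_radius T)\<^sup>2
            + 1 / 8 * numerical_radius (\<lambda>x. T (Q x) + Q (T x)))
    \<and> sqrt (1 / 16 * (onorm Q)\<^sup>2 + 1 / 4 * (numerical_radius T)\<^sup>2
            + 1 / 8 * numerical_radius (\<lambda>x. T (Q x) + Q (T x)))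
        \<le> 1 / 4 * onorm (\<lambda>x. op_powr (op_abs (cadjoint T)) (2 * (1 - t)) x
                              + op_powr (op_abs T) (2 * t) x)
          + 1 / 2 * numerical_radius T
    \<and> 1 / 4 * onorm (\<lambda>x. op_powr (op_abs (cadjoint T)) (2 * (1 - t)) x
                              + op_powr (op_abs T) (2 * t) x)
          + 1 / 2 * numerical_radius T
        \<le> 1 / 2 * onorm (\<lambda>x. op_powr (op_abs (cadjoint T)) (2 * (1 - t)) x
                              + op_powr (op_abs T) (2 * t) x)"
proof -
  let ?P = "op_abs T" and ?R = "op_abs (cadjoint T)"
  note T = assms(1)
  have P: "positive_upto (onorm ?P) ?P" by (rule positive_op_abs[OF T order_refl])
  have R: "positive_upto (onorm ?R) ?R"
    by (rule positive_op_abs[OF bounded_clinear_cadjoint[OF T] order_refl])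
  have "selfadjoint (op_powr ?R (2 * (1 - t)))" "selfadjoint (op_powr ?P (2 * t))"
    using assms(2,3) by (intro selfadjoint_op_powr[OF R] selfadjoint_op_powr[OF P]; simp)+
  then have Q: "selfadjoint Q"
    unfolding assms(4) selfadjoint_def bounded_clinear_def
    by (simp add: bounded_linear_add inner_add_left inner_add_right scaleC_add_right)
  have dom: "2 * cmod (cinner (T x) x) \<le> inner (Q x) x" for x
  proof -
    \<comment> \<open>The exponents t and 1 - t sum to 1 as mixed Schwarz requires; squaring these
      norms doubles them to the exponents in Q.\<close>
    let ?p = "norm (op_powr ?P t x)" and ?r = "norm (op_powr ?R (1 - t) x)"
    have "2 * cmod (cinner (T x) x) \<le> 2 * (?p * ?r)"
      using mixed_Schwarz[OF T, of t "1 - t" x] assms(2,3) by simp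
    also have "\<dots> \<le> ?p\<^sup>2 + ?r\<^sup>2" using sum_squares_bound[of ?p ?r] by simp
    also have "\<dots> = inner (Q x) x"
      using assms(2,3) by (simp add: norm_op_powr[OF P] norm_op_powr[OF R] assms(4) inner_add_left)
    finally show ?thesis .
  qed
  \<comment> \<open>The last inequality of the chain is w \<le> |Q|/2, halved and added to
    |Q|/4.\<close>
  show ?thesis
    using numerical_radius_refinement[OF T Q dom] unfolding assms(4)[symmetric] by simp
qed


end
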